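(* For positive integers $m,n$ let $\mathcal{I}(m,n)$ denote the probability that the map $x \mapsto \operatorname{ReLU}(Wx)$, $\mathbb{R}^n \to \mathbb{R}^m$, is injective, where $W \in \mathbb{R}^{m\times n}$ has iid standard normal entries. Let $c = m/n$ be held fixed as $n \to \infty$. Then $\mathcal{I}(m,n) \to 1$ if $c \geq 10.5$, and $\mathcal{I}(m,n) \to 0$ if $c \leq 3.3$.
   Context: $\operatorname{ReLU}(y)=\max(y,0)$ applied componentwise. *)

theory Defs
  imports "HOL-Probability.Probability"
begin

text \<open>Vectors in R^n are represented as functions nat => real vanishing outside {..<n};
  an m x n matrix W is a function on index pairs (i,j) with i<m, j<n.\<close>

definition vecs :: "nat \<Rightarrow> (nat \<Rightarrow> real) set" where
  "vecs n = {x. \<forall>j. n \<le> j \<longrightarrow> x j = 0}"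

definition ReLU :: "real \<Rightarrow> real" where
  "ReLU y = max y 0"

definition relu_layer :: "nat \<Rightarrow> nat \<Rightarrow> (nat \<times> nat \<Rightarrow> real) \<Rightarrow> (nat \<Rightarrow> real) \<Rightarrow> (nat \<Rightarrow> real)" where
  "relu_layer m n W x = (\<lambda>i. if i < m then ReLU (\<Sum>j<n. W (i, j) * x j) else 0)"

definition gauss_matrix :: "nat \<Rightarrow> nat \<Rightarrow> (nat \<times> nat \<Rightarrow> real) measure" where
  "gauss_matrix m n = PiM ({..<m} \<times> {..<n}) (\<lambda>_. density lborel std_normal_density)"

definition inj_prob :: "nat \<Rightarrow> nat \<Rightarrow> real" where
  "inj_prob m n = measure (gauss_matrix m n)
     {W \<in> space (gauss_matrix m n). inj_on (relu_layer m n W) (vecs n)}"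

end

theory Submission
  imports Defs "HOL-Real_Asymp.Real_Asymp"
begin

text \<open>
  The layer fails to be injective iff for some set \<open>A\<close> of rows there are a nonzero \<open>d\<close> orthogonal to the
  rows in \<open>A\<close> and a \<open>z\<close> having negative inner product with all other rows.

  \<^emph>\<open>Many rows.\<close> Almost surely any \<open>n\<close> rows are linearly independent, so failure forces \<open>m - n + 1\<close> rows
  into an open half-space. Flipping the signs of \<open>N\<close> rows independently preserves the law, and at most
  \<open>\<Sum>k\<le>n. N choose k\<close> of the \<open>2 ^ N\<close> sign patterns are realised by linear functionals (Pajor's form of
  the Sauer-Shelah lemma), so \<open>N\<close> given rows lie in a half-space with probability at most
  \<open>(\<Sum>k\<le>n. N choose k) / 2 ^ N\<close>. A union bound over the \<open>m choose (n - 1)\<close> sets of rows is exponentially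
  small once \<open>m \<ge> 10.4 n\<close>.

  \<^emph>\<open>Few rows.\<close> It suffices to find \<open>x\<close> with fewer than \<open>n\<close> nonnegative inner products, and minus the sum
  of the rows works. The matrix has the same law as \<open>g\<close> with its normalised column sums replaced by an
  independent Gaussian vector \<open>h\<close>. Conditionally on \<open>h\<close>, the number of nonnegative inner products is the
  number of \<open>i\<close> with \<open>\<xi> i \<le> mean \<xi> - \<parallel>h\<parallel> / sqrt m\<close> for iid standard normal \<open>\<xi> i\<close>. As \<open>\<parallel>h\<parallel>\<close> is close to
  \<open>sqrt n\<close>, this is about \<open>m\<close> times the Gaussian tail at \<open>sqrt (n / m)\<close>, which is below \<open>n\<close> for
  \<open>m \<le> 10 n / 3\<close>.
\<close>

subsection \<open>Linear systems and sign patterns\<close>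

text \<open>Gaussian elimination, one equation at a time. An equation whose coefficients vanish on
  \<open>B\<close> costs nothing; any other one is solved for a pivot variable \<open>j0\<close>,
  which removes one equation and one unknown. Elimination alters both the unknowns and the
  coefficients, so the induction leaves \<open>B\<close> and \<open>w\<close> arbitrary.\<close>

lemma underdetermined_system_nontrivial_solution:
  fixes w :: "'a \<Rightarrow> 'b \<Rightarrow> real"
  assumes "finite A" "finite B" "card A < card B"
  shows "\<exists>d. (\<forall>j. j \<notin> B \<longrightarrow> d j = 0) \<and> (\<exists>j\<in>B. d j \<noteq> 0) \<and> (\<forall>i\<in>A. (\<Sum>j\<in>B. w i j * d j) = 0)"
  using assms
proof (induction A arbitrary: B w rule: finite_induct)
  case empty
  then obtain j where "j \<in> B" by fastforce
  then show ?case by (intro exI[of _ "\<lambda>k. if k = j then 1 else 0"]) auto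
next
  case (insert i A)
  show ?case
  proof (cases "\<forall>j\<in>B. w i j = 0")
    case True
    obtain d where d: "\<forall>j. j \<notin> B \<longrightarrow> d j = 0" "\<exists>j\<in>B. d j \<noteq> 0"
      "\<forall>i\<in>A. (\<Sum>j\<in>B. w i j * d j) = 0"
      using insert.IH[of B w] insert.prems insert.hyps by (metis Suc_lessD card_insert_disjoint)
    then show ?thesis using True by (intro exI[of _ d]) auto
  next
    case False
    then obtain j0 where j0: "j0 \<in> B" "w i j0 \<noteq> 0" by auto
    define B' where "B' = B - {j0}"
    have B: "B = insert j0 B'" "j0 \<notin> B'" "finite B'" using j0 insert by (auto simp: B'_def)
    \<comment> \<open>Coefficients after the pivot variable has been substituted out by means of
      equation \<open>i\<close>. Since \<open>w' i\<close> vanishes identically,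
      \<open>sum_e\<close> also yields equation \<open>i\<close> itself.\<close>
    define w' where "w' k j = w k j - w k j0 * w i j / w i j0" for k j
    obtain d where d: "\<forall>j. j \<notin> B' \<longrightarrow> d j = 0" "\<exists>j\<in>B'. d j \<noteq> 0"
      "\<forall>k\<in>A. (\<Sum>j\<in>B'. w' k j * d j) = 0"
      using insert.IH[of B' w'] insert.prems insert.hyps B by (auto simp: B(1))
    define s where "s = (\<Sum>j\<in>B'. w i j * d j)"
    \<comment> \<open>Back-substitution: the value at \<open>j0\<close> is the one forced by
      equation \<open>i\<close>.\<close>
    define e where "e = d(j0 := - s / w i j0)"
    have sum_e: "(\<Sum>j\<in>B. w k j * e j) = (\<Sum>j\<in>B'. w' k j * d j)" for k
    proof -
      have "(\<Sum>j\<in>B. w k j * e j) = w k j0 * e j0 + (\<Sum>j\<in>B'. w k j * e j)"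
        using B by simp
      also have "(\<Sum>j\<in>B'. w k j * e j) = (\<Sum>j\<in>B'. w k j * d j)"
        by (rule sum.cong) (use B in \<open>auto simp: e_def\<close>)
      also have "w k j0 * e j0 = - (\<Sum>j\<in>B'. w k j0 * w i j / w i j0 * d j)"
        by (simp add: e_def s_def sum_distrib_left sum_divide_distrib mult_ac flip: sum_negf)
      finally show ?thesis by (simp add: w'_def algebra_simps sum_subtractf)
    qed
    have "(\<Sum>j\<in>B'. w' i j * d j) = 0" using j0 by (simp add: w'_def)
    then show ?thesis
      using d B sum_e by (intro exI[of _ e]) (auto simp: e_def)
  qed
qed

section \<open>Shattering and the number of sign patterns\<close>

text \<open>Shattering in the sense of Vapnik and Chervonenkis.\<close>

definition shattered :: "'a set set \<Rightarrow> 'a set \<Rightarrow> bool" where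
  "shattered F S \<longleftrightarrow> (\<forall>U\<subseteq>S. \<exists>X\<in>F. X \<inter> S = U)"

text \<open>Split the family at \<open>a\<close> into \<open>F0\<close>, the members avoiding
  \<open>a\<close>, and \<open>F1\<close>, the members containing \<open>a\<close> with
  \<open>a\<close> removed. A subset of \<open>T\<close> shattered by either part is shattered by
  \<open>F\<close>, and one shattered by both remains shattered by \<open>F\<close> after
  \<open>a\<close> is added. Hence the union and the intersection of the two collections of
  shattered sets both contribute to the sets shattered by \<open>F\<close>.\<close>

lemma card_le_card_shattered:
  assumes "finite T" "F \<subseteq> Pow T"
  shows "card F \<le> card {S\<in>Pow T. shattered F S}"
  using assms
proof (induction T arbitrary: F rule: finite_induct)
  case empty
  show ?case
  proof (cases "F = {}")
    case False
    with empty have "F = {{}}" by auto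
    then have "{S\<in>Pow {}. shattered F S} = {{}}" by (auto simp: shattered_def)
    then show ?thesis using \<open>F = {{}}\<close> by simp
  qed auto
next
  case (insert a T)
  define F0 where "F0 = {S\<in>F. a \<notin> S}"
  define F1 where "F1 = (\<lambda>S. S - {a}) ` {S\<in>F. a \<in> S}"
  let ?sh = "\<lambda>T F. {S\<in>Pow T. shattered F S}"
  have finF: "finite F" using insert.prems insert.hyps by (meson finite_Pow_iff finite_insert finite_subset)
  have "card F = card F0 + card {S\<in>F. a \<in> S}"
    using finF by (subst card_Un_disjoint[symmetric]) (auto simp: F0_def intro!: arg_cong[of _ _ card])
  also have "card {S\<in>F. a \<in> S} = card F1"
    unfolding F1_def by (rule card_image[symmetric]) (auto simp: inj_on_def)
  also have "card F0 + card F1 \<le> card (?sh T F0) + card (?sh T F1)"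
    by (intro add_mono insert.IH) (use insert.prems in \<open>auto simp: F0_def F1_def\<close>)
  also have "\<dots> = card (?sh T F0 \<union> ?sh T F1) + card (?sh T F0 \<inter> ?sh T F1)"
    using insert.hyps by (intro card_Un_Int) auto
  \<comment> \<open>The intersection is counted a second time through its copies with
    \<open>a\<close> inserted; these contain \<open>a\<close> and so are disjoint from the union,
    which consists of subsets of \<open>T\<close>.\<close>
  also have "card (?sh T F0 \<inter> ?sh T F1) = card (insert a ` (?sh T F0 \<inter> ?sh T F1))"
    by (rule card_image[symmetric]) (use insert.hyps in \<open>auto simp: inj_on_def; blast\<close>)
  also have "card (?sh T F0 \<union> ?sh T F1) + card (insert a ` (?sh T F0 \<inter> ?sh T F1))
    = card ((?sh T F0 \<union> ?sh T F1) \<union> insert a ` (?sh T F0 \<inter> ?sh T F1))"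
    by (rule card_Un_disjoint[symmetric]) (use insert.hyps in auto)
  also have "\<dots> \<le> card (?sh (insert a T) F)"
  proof (rule card_mono)
    show "finite (?sh (insert a T) F)" using insert.hyps by auto
    have 1: "shattered F S" if "S \<subseteq> T" "shattered F0 S" for S
      using that unfolding shattered_def F0_def by blast
    have 2: "shattered F S" if S: "S \<subseteq> T" "shattered F1 S" for S
      unfolding shattered_def
    proof (intro allI impI)
      fix U assume "U \<subseteq> S"
      then obtain X where X: "X \<in> F1" "X \<inter> S = U" using S(2) unfolding shattered_def by meson
      then obtain Y where "Y \<in> F" "X = Y - {a}" by (auto simp: F1_def)
      moreover have "a \<notin> S" using S insert.hyps by auto
      ultimately have "Y \<inter> S = U" using X by blast
      then show "\<exists>X\<in>F. X \<inter> S = U" using \<open>Y \<in> F\<close> by blast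
    qed
    have 3: "shattered F (insert a S)" if S: "S \<subseteq> T" "shattered F0 S" "shattered F1 S" for S
      unfolding shattered_def
    proof (intro allI impI)
      fix U assume U: "U \<subseteq> insert a S"
      have aS: "a \<notin> S" using S insert.hyps by auto
      have US: "U - {a} \<subseteq> S" using U by auto
      show "\<exists>X\<in>F. X \<inter> insert a S = U"
      proof (cases "a \<in> U")
        case True
        obtain X where X: "X \<in> F1" "X \<inter> S = U - {a}" using S US unfolding shattered_def by meson
        then obtain Y where Y: "Y \<in> F" "a \<in> Y" "X = Y - {a}" by (auto simp: F1_def)
        then show ?thesis using X True aS by (intro bexI[of _ Y]) auto
      next
        case False
        obtain X where X: "X \<in> F0" "X \<inter> S = U - {a}" using S US unfolding shattered_def by meson
        then show ?thesis using False by (intro bexI[of _ X]) (auto simp: F0_def)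
      qed
    qed
    show "?sh T F0 \<union> ?sh T F1 \<union> insert a ` (?sh T F0 \<inter> ?sh T F1) \<subseteq> ?sh (insert a T) F"
      using 1 2 3 by auto
  qed
  finally show ?case .
qed

text \<open>A linear dependency among the rows forbids the sign pattern of its own coefficients.\<close>

lemma card_shattered_sign_patterns_le:
  fixes w :: "'a \<Rightarrow> nat \<Rightarrow> real"
  assumes "finite S" and sh: "shattered {{i\<in>T. (\<Sum>j<n. w i j * x j) < 0} |x. x \<in> vecs n} S" and "S \<subseteq> T"
  shows "card S \<le> n"
proof (rule ccontr)
  assume "\<not> card S \<le> n"
  then have "card {..<n} < card S" by simp
  \<comment> \<open>The roles are transposed here: the equations are indexed by the \<open>n\<close>
    columns and the unknowns by the rows in \<open>S\<close>.\<close>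
  from underdetermined_system_nontrivial_solution[OF _ \<open>finite S\<close> this, of "\<lambda>j i. w i j"]
  obtain a0 i0 where a0: "i0 \<in> S" "a0 i0 \<noteq> 0" "\<forall>j<n. (\<Sum>i\<in>S. w i j * a0 i) = 0"
    by auto
  \<comment> \<open>The factor \<open>- a0 i0\<close> makes the coefficient at \<open>i0\<close>
    negative. If the rows of \<open>S\<close> realise the pattern of negative coefficients of
    \<open>a\<close>, every term of the paired sum is nonnegative and the one at \<open>i0\<close>
    is positive, while the dependency makes the sum zero.\<close>
  define a where "a i = - a0 i0 * a0 i" for i
  have a: "a i0 < 0" "\<And>j. j < n \<Longrightarrow> (\<Sum>i\<in>S. w i j * a i) = 0"
    using a0 by (auto simp: a_def mult.left_commute[of _ "a0 i0"] sum_negf zero_less_mult_iff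
        simp flip: sum_distrib_left)
  obtain x where x: "{i\<in>T. (\<Sum>j<n. w i j * x j) < 0} \<inter> S = {i\<in>S. a i < 0}"
    using sh[unfolded shattered_def, rule_format, of "{i\<in>S. a i < 0}"] by auto
  have "0 = (\<Sum>j<n. x j * (\<Sum>i\<in>S. w i j * a i))" using a by simp
  also have "\<dots> = (\<Sum>i\<in>S. a i * (\<Sum>j<n. w i j * x j))"
    by (subst (2) sum_distrib_left, subst sum_distrib_left, subst sum.swap) (simp add: mult_ac)
  also have "\<dots> > 0"
  proof (rule sum_pos2[OF \<open>finite S\<close> \<open>i0 \<in> S\<close>])
    show "0 < a i0 * (\<Sum>j<n. w i0 j * x j)"
      using x a(1) a0(1) by (auto intro!: mult_neg_neg)
    fix i assume i: "i \<in> S"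
    show "0 \<le> a i * (\<Sum>j<n. w i j * x j)"
    proof (cases "a i < 0")
      case True
      then have "(\<Sum>j<n. w i j * x j) < 0" using x i by auto
      then show ?thesis using True by (simp add: mult_nonpos_nonpos)
    next
      case False
      then have "\<not> (\<Sum>j<n. w i j * x j) < 0" using x i \<open>S \<subseteq> T\<close> by blast
      then show ?thesis using False by simp
    qed
  qed
  finally show False by simp
qed

text \<open>A Chernoff-type bound: for \<open>k\<close> up to \<open>n\<close> the weight
  \<open>t ^ k\<close> is at least \<open>t ^ n\<close>, so inserting the weights and completing the
  sum gives the full binomial expansion of \<open>(1 + t) ^ N\<close>. The parameter
  \<open>t\<close> is left free and chosen later.\<close>

lemma sum_binomial_le:
  fixes t :: real
  assumes "0 < t" "t \<le> 1"
  shows "(\<Sum>k\<le>n. real (N choose k)) \<le> (1 + t) ^ N / t ^ n"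
proof -
  have "(\<Sum>k\<le>n. real (N choose k)) * t ^ n \<le> (\<Sum>k\<le>n. real (N choose k) * t ^ k)"
    unfolding sum_distrib_right
    by (intro sum_mono mult_left_mono power_decreasing) (use assms in auto)
  \<comment> \<open>\<open>n\<close> may exceed \<open>N\<close>, so both ranges are embedded in a
    common one; the surplus binomial coefficients are zero.\<close>
  also have "\<dots> \<le> (\<Sum>k\<le>max n N. real (N choose k) * t ^ k)"
    by (rule sum_mono2) (use assms in auto)
  also have "\<dots> = (\<Sum>k\<le>N. real (N choose k) * t ^ k)"
    by (rule sum.mono_neutral_right) (auto simp: binomial_eq_0)
  also have "\<dots> = (1 + t) ^ N"
    using binomial_ring[of t 1 N] by (simp add: add.commute)
  finally show ?thesis using assms by (simp add: field_simps)
qed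

text \<open>The family of patterns shatters at least as many sets as it has members, and it shatters
  only sets of at most \<open>n\<close> rows, so it suffices to count the small subsets of
  \<open>T\<close>.\<close>

lemma card_sign_patterns_le:
  fixes w :: "'a \<Rightarrow> nat \<Rightarrow> real"
  assumes "finite T"
  shows "card {{i\<in>T. (\<Sum>j<n. w i j * x j) < 0} |x. x \<in> vecs n} \<le> (\<Sum>k\<le>n. card T choose k)"
    (is "card ?F \<le> _")
proof -
  have "card ?F \<le> card {S\<in>Pow T. shattered ?F S}"
    by (rule card_le_card_shattered) (use assms in auto)
  also have "\<dots> \<le> card (\<Union>k\<in>{..n}. {S. S \<subseteq> T \<and> card S = k})"
  proof (rule card_mono)
    show "finite (\<Union>k\<in>{..n}. {S. S \<subseteq> T \<and> card S = k})"
      by (rule finite_subset[of _ "Pow T"]) (use assms in auto)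
    show "{S\<in>Pow T. shattered ?F S} \<subseteq> (\<Union>k\<in>{..n}. {S. S \<subseteq> T \<and> card S = k})"
    proof
      fix S assume S: "S \<in> {S\<in>Pow T. shattered ?F S}"
      then have "card S \<le> n"
        by (intro card_shattered_sign_patterns_le[of S T w n] finite_subset[OF _ assms]) auto
      with S show "S \<in> (\<Union>k\<in>{..n}. {S. S \<subseteq> T \<and> card S = k})" by auto
    qed
  qed
  also have "\<dots> \<le> (\<Sum>k\<le>n. card {S. S \<subseteq> T \<and> card S = k})"
    by (rule card_UN_le) auto
  also have "\<dots> = (\<Sum>k\<le>n. card T choose k)"
    using assms by (simp add: n_subsets)
  finally show ?thesis .
qed

section \<open>Collisions of the layer as a linear condition\<close>

text \<open>Given a collision of \<open>x\<close> and \<open>y\<close>, let \<open>A\<close> be the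
  rows on which the values before ReLU agree. The difference is orthogonal to these rows. On any
  other row two different values have the same positive part, so both are nonpositive and not both
  zero, and the sum \<open>x + y\<close> has negative inner product with the row. Conversely
  \<open>z\<close> and \<open>z + s * d\<close> collide for small positive \<open>s\<close>: rows in
  \<open>A\<close> do not see \<open>d\<close>, and all other rows are switched off for both
  inputs.\<close>

lemma inj_relu_layer_iff:
  "inj_on (relu_layer m n W) (vecs n) \<longleftrightarrow>
    \<not> (\<exists>A\<subseteq>{..<m}. (\<exists>d\<in>vecs n. (\<exists>j<n. d j \<noteq> 0) \<and> (\<forall>i\<in>A. (\<Sum>j<n. W (i, j) * d j) = 0)) \<and>
      (\<exists>z\<in>vecs n. \<forall>i\<in>{..<m} - A. (\<Sum>j<n. W (i, j) * z j) < 0))" (is "?L \<longleftrightarrow> \<not> ?R")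
proof -
  have "?R" if noninj: "\<not> ?L"
  proof -
    obtain x y where xy: "x \<in> vecs n" "y \<in> vecs n" "x \<noteq> y" "relu_layer m n W x = relu_layer m n W y"
      using noninj by (auto simp: inj_on_def)
    define p where "p i = (\<Sum>j<n. W (i, j) * x j)" for i
    define q where "q i = (\<Sum>j<n. W (i, j) * y j)" for i
    have eq: "max (p i) 0 = max (q i) 0" if "i < m" for i
      using fun_cong[OF xy(4), of i] that by (simp add: relu_layer_def ReLU_def p_def q_def)
    define A where "A = {i. i < m \<and> p i = q i}"
    define d where "d j = x j - y j" for j
    define z where "z j = x j + y j" for j
    have "d \<in> vecs n" "z \<in> vecs n" using xy by (auto simp: vecs_def d_def z_def)
    moreover have "\<exists>j<n. d j \<noteq> 0"
    proof -
      obtain j where "x j \<noteq> y j" using xy by auto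
      moreover from this have "j < n" using xy by (cases "j < n") (auto simp: vecs_def)
      ultimately show ?thesis by (auto simp: d_def)
    qed
    moreover have "\<forall>i\<in>A. (\<Sum>j<n. W (i, j) * d j) = 0"
      by (auto simp: A_def p_def q_def d_def algebra_simps sum_subtractf)
    moreover have "\<forall>i\<in>{..<m} - A. (\<Sum>j<n. W (i, j) * z j) < 0"
    proof
      fix i assume "i \<in> {..<m} - A"
      then have "i < m" "p i \<noteq> q i" by (auto simp: A_def)
      with eq[of i] have "p i + q i < 0" by (auto simp: max_def split: if_splits)
      then show "(\<Sum>j<n. W (i, j) * z j) < 0"
        by (simp add: p_def q_def z_def algebra_simps sum.distrib)
    qed
    moreover have "A \<subseteq> {..<m}" by (auto simp: A_def)
    ultimately show ?R by blast
  qed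
  moreover have "\<not> ?L" if R: "?R"
  proof -
    obtain A d z where A: "A \<subseteq> {..<m}" "d \<in> vecs n" "\<exists>j<n. d j \<noteq> 0"
      "\<forall>i\<in>A. (\<Sum>j<n. W (i, j) * d j) = 0" "z \<in> vecs n"
      "\<forall>i\<in>{..<m} - A. (\<Sum>j<n. W (i, j) * z j) < 0" using R by blast
    define p where "p i = (\<Sum>j<n. W (i, j) * d j)" for i
    define q where "q i = (\<Sum>j<n. W (i, j) * z j)" for i
    \<comment> \<open>Strict negativity is an open condition, so finitely many such inequalities
      survive a small perturbation along \<open>d\<close>.\<close>
    have "\<exists>s>0. \<forall>i\<in>{..<m} - A. q i + s * p i < 0"
    proof -
      have "((\<lambda>s. q i + s * p i) \<longlongrightarrow> q i + 0 * p i) (at_right 0)" for i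
        by (intro tendsto_intros)
      then have "\<forall>\<^sub>F s in at_right 0. q i + s * p i < 0" if "i \<in> {..<m} - A" for i
        using order_tendstoD(2)[of "\<lambda>s. q i + s * p i" "q i" "at_right 0" 0] A(6) that by (auto simp: q_def)
      then have "\<forall>\<^sub>F s in at_right 0. (\<forall>i\<in>{..<m} - A. q i + s * p i < 0) \<and> s > 0"
        by (intro eventually_conj eventually_ball_finite eventually_at_right_less) auto
      then show ?thesis using eventually_happens by fastforce
    qed
    then obtain s where s: "s > 0" "\<forall>i\<in>{..<m} - A. q i + s * p i < 0" by auto
    define x where "x j = z j + s * d j" for j
    have xz: "(\<Sum>j<n. W (i, j) * x j) = q i + s * p i" for i
      by (simp add: x_def q_def p_def algebra_simps sum.distrib sum_distrib_left)
    have "relu_layer m n W x = relu_layer m n W z"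
    proof
      fix i
      show "relu_layer m n W x i = relu_layer m n W z i"
      proof (cases "i \<in> A")
        case True
        then show ?thesis using A(4) by (simp add: relu_layer_def xz flip: q_def) (simp add: p_def)
      next
        case False
        then show ?thesis using A(6) s by (auto simp: relu_layer_def xz ReLU_def simp flip: q_def)
      qed
    qed
    moreover have "x \<in> vecs n" using A by (auto simp: x_def vecs_def)
    moreover have "x \<noteq> z" using A(3) s(1) by (auto simp: x_def fun_eq_iff)
    ultimately show ?thesis using A(5) by (auto simp: inj_on_def)
  qed
  ultimately show ?thesis by blast
qed

section \<open>The Gaussian matrix as a probability space\<close>

abbreviation std_gauss :: "real measure" where
  "std_gauss \<equiv> density lborel std_normal_density"

lemma prob_space_std_gauss: "prob_space std_gauss"
  by (rule prob_space_normal_density) simp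

lemma product_prob_space_std_gauss: "product_prob_space (\<lambda>_. std_gauss)"
  by (simp add: product_prob_spaceI prob_space_std_gauss)

lemma prob_space_gauss_matrix: "prob_space (gauss_matrix m n)"
  unfolding gauss_matrix_def by (rule prob_space_PiM) (rule prob_space_std_gauss)

lemma measurable_gauss_matrix_row [measurable]:
  assumes "i < m"
  shows "(\<lambda>W. \<Sum>j<n. W (i, j) * x j) \<in> borel_measurable (gauss_matrix m n)"
proof -
  have "(\<lambda>W. W (i, j)) \<in> borel_measurable (gauss_matrix m n)" if "j < n" for j
    unfolding gauss_matrix_def
    using assms that measurable_component_singleton[of "(i, j)" "{..<m} \<times> {..<n}" "\<lambda>_. std_gauss"]
    by (simp add: measurable_cong_sets[OF refl, of std_gauss borel])
  then show ?thesis by (intro borel_measurable_sum borel_measurable_times) auto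
qed

subsection \<open>Measurability of the injectivity event\<close>

definition rat_vecs :: "nat \<Rightarrow> (nat \<Rightarrow> real) set" where
  "rat_vecs n = {x \<in> vecs n. \<forall>j. x j \<in> \<rat>}"

lemma countable_rat_vecs: "countable (rat_vecs n)"
proof -
  have "rat_vecs n \<subseteq> (\<lambda>f j. if j < n then f j else 0) ` (PiE {..<n} (\<lambda>_. \<rat>))"
  proof
    fix x assume x: "x \<in> rat_vecs n"
    have "x = (\<lambda>j. if j < n then restrict x {..<n} j else 0)"
      using x by (auto simp: rat_vecs_def vecs_def fun_eq_iff)
    moreover have "restrict x {..<n} \<in> PiE {..<n} (\<lambda>_. \<rat>)"
      using x by (auto simp: rat_vecs_def)
    ultimately show "x \<in> (\<lambda>f j. if j < n then f j else 0) ` (PiE {..<n} (\<lambda>_. \<rat>))" by blast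
  qed
  moreover have "countable (PiE {..<n} (\<lambda>_. \<rat> :: real set))"
    by (intro countable_PiE) (auto intro: countable_rat)
  ultimately show ?thesis by (meson countable_image countable_subset)
qed

text \<open>Rounding down to multiples of \<open>1 / Suc k\<close> leaves integers fixed and does
  not leave the interval from -1 to 1. The approximations therefore keep the zeros beyond
  \<open>n\<close>, a coordinate normalised to 1, and the bound 1 on all coordinates, so they stay
  in the sets over which the quantifiers range.\<close>

definition rat_approx :: "(nat \<Rightarrow> real) \<Rightarrow> nat \<Rightarrow> nat \<Rightarrow> real" where
  "rat_approx x k j = of_int \<lfloor>x j * of_nat (Suc k)\<rfloor> / of_nat (Suc k)"

lemma rat_approx_in_rat_vecs: "x \<in> vecs n \<Longrightarrow> rat_approx x k \<in> rat_vecs n"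
  by (auto simp: rat_vecs_def vecs_def rat_approx_def)

lemma rat_approx_tendsto: "(\<lambda>k. rat_approx x k j) \<longlonglongrightarrow> x j"
proof -
  have "(\<lambda>k. of_int \<lfloor>x j * of_nat k\<rfloor> / of_nat k) \<longlonglongrightarrow> x j"
    by real_asymp
  then show ?thesis unfolding rat_approx_def by (rule LIMSEQ_Suc)
qed

lemma rat_approx_eq_1: "x j = 1 \<Longrightarrow> rat_approx x k j = 1"
  unfolding rat_approx_def by (simp only: mult_1 floor_of_nat) simp

lemma abs_rat_approx_le_1: 
  assumes "\<bar>x j\<bar> \<le> 1" shows "\<bar>rat_approx x k j\<bar> \<le> 1"
proof -
  have 1: "x j * real (Suc k) \<le> real (Suc k)" "- real (Suc k) \<le> x j * real (Suc k)"
    using mult_right_mono[of "x j" 1 "real (Suc k)"] mult_right_mono[of "-1" "x j" "real (Suc k)"] assms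
    by (auto simp del: of_nat_Suc)
  have "\<lfloor>x j * real (Suc k)\<rfloor> \<le> \<lfloor>real (Suc k)\<rfloor>" using 1(1) by (rule floor_mono)
  moreover have "- int (Suc k) \<le> \<lfloor>x j * real (Suc k)\<rfloor>" using 1(2) by (simp add: le_floor_iff del: of_nat_Suc)
  ultimately have "\<bar>\<lfloor>x j * real (Suc k)\<rfloor>\<bar> \<le> int (Suc k)" by (simp del: of_nat_Suc)
  then have "\<bar>real_of_int \<lfloor>x j * real (Suc k)\<rfloor>\<bar> \<le> real (Suc k)"
    by (metis of_int_abs of_int_le_iff of_int_of_nat_eq)
  then show ?thesis by (simp add: rat_approx_def del: of_nat_Suc)
qed

text \<open>The finitely many strict inequalities are open in \<open>z\<close>, so a witness may be
  taken rational and the event becomes a countable union.\<close>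

lemma sets_gauss_matrix_neg_event:
  assumes T: "T \<subseteq> {..<m}"
  shows "{W \<in> space (gauss_matrix m n). \<exists>z\<in>vecs n. \<forall>i\<in>T. (\<Sum>j<n. W (i, j) * z j) < 0} \<in> sets (gauss_matrix m n)"
proof -
  have fin: "finite T" using T finite_subset by blast
  have "(\<exists>z\<in>vecs n. \<forall>i\<in>T. (\<Sum>j<n. W (i, j) * z j) < 0) \<longleftrightarrow>
        (\<exists>z\<in>rat_vecs n. \<forall>i\<in>T. (\<Sum>j<n. W (i, j) * z j) < 0)" for W
  proof
    assume "\<exists>z\<in>vecs n. \<forall>i\<in>T. (\<Sum>j<n. W (i, j) * z j) < 0"
    then obtain z where z: "z \<in> vecs n" "\<And>i. i \<in> T \<Longrightarrow> (\<Sum>j<n. W (i, j) * z j) < 0" by auto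
    have "(\<lambda>k. \<Sum>j<n. W (i, j) * rat_approx z k j) \<longlonglongrightarrow> (\<Sum>j<n. W (i, j) * z j)" for i
      by (intro tendsto_intros rat_approx_tendsto)
    then have "\<forall>\<^sub>F k in sequentially. (\<Sum>j<n. W (i, j) * rat_approx z k j) < 0" if "i \<in> T" for i
      using order_tendstoD(2) z(2)[OF that] by blast
    then have "\<forall>\<^sub>F k in sequentially. \<forall>i\<in>T. (\<Sum>j<n. W (i, j) * rat_approx z k j) < 0"
      by (intro eventually_ball_finite fin) auto
    then obtain k where "\<forall>i\<in>T. (\<Sum>j<n. W (i, j) * rat_approx z k j) < 0"
      by (auto simp: eventually_sequentially)
    then show "\<exists>z\<in>rat_vecs n. \<forall>i\<in>T. (\<Sum>j<n. W (i, j) * z j) < 0"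
      using rat_approx_in_rat_vecs[OF z(1)] by blast
  qed (auto simp: rat_vecs_def)
  moreover have "{W \<in> space (gauss_matrix m n). \<exists>z\<in>rat_vecs n. \<forall>i\<in>T. (\<Sum>j<n. W (i, j) * z j) < 0} \<in> sets (gauss_matrix m n)"
  proof (intro sets.sets_Collect_countable_Ex' countable_rat_vecs sets.sets_Collect_finite_All fin)
    fix z i assume "i \<in> T"
    then have [measurable]: "(\<lambda>W. \<Sum>j<n. W (i, j) * z j) \<in> borel_measurable (gauss_matrix m n)"
      using T by (intro measurable_gauss_matrix_row) auto
    show "{W \<in> space (gauss_matrix m n). (\<Sum>j<n. W (i, j) * z j) < 0} \<in> sets (gauss_matrix m n)"
      by measurable
  qed
  ultimately show ?thesis by simp
qed

text \<open>Being a kernel vector is an equation, which rational approximation does not preserve, so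
  measurability of the kernel event goes through compactness. Dividing a nonzero vector by a
  coordinate of largest absolute value, at index \<open>j\<close>, brings it into this set.\<close>

definition normalized_vecs :: "nat \<Rightarrow> nat \<Rightarrow> (nat \<Rightarrow> real) set" where
  "normalized_vecs n j = {d \<in> vecs n. d j = 1 \<and> (\<forall>k. \<bar>d k\<bar> \<le> 1)}"

lemma compact_normalized_vecs: "compact (normalized_vecs n j)"
proof -
  \<comment> \<open>The set is a product of intervals and singletons, hence compact by Tychonoff's
    theorem. For \<open>j \<ge> n\<close> the factor at \<open>j\<close> is empty, in agreement with
    \<open>normalized_vecs n j\<close> being empty.\<close>
  define S where "S k = (if k = j then {1} else {-1..1}) \<inter> (if k < n then UNIV else {0::real})" for k
  have S: "x \<in> S k \<longleftrightarrow> (n \<le> k \<longrightarrow> x = 0) \<and> (k = j \<longrightarrow> x = 1) \<and> \<bar>x\<bar> \<le> 1" for x k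
    by (auto simp: S_def)
  have "normalized_vecs n j = PiE UNIV S"
    unfolding normalized_vecs_def vecs_def by (auto simp: PiE_iff S)
  moreover have "compactin (product_topology (\<lambda>_. euclidean) UNIV) (PiE UNIV S)"
    unfolding compactin_PiE by (auto simp: S_def)
  ultimately show ?thesis by (simp add: euclidean_product_topology)
qed

text \<open>The residual \<open>f W\<close> is continuous and attains its minimum on the compact
  set. It has a zero there iff it takes arbitrarily small values, and by density these can be sought
  at rational points, which leaves only countable operations.\<close>

lemma sets_gauss_matrix_normalized_kernel_event:
  assumes A: "A \<subseteq> {..<m}"
  shows "{W \<in> space (gauss_matrix m n). \<exists>d\<in>normalized_vecs n j. \<forall>i\<in>A. (\<Sum>k<n. W (i, k) * d k) = 0}
    \<in> sets (gauss_matrix m n)"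
proof -
  have fin: "finite A" using A finite_subset by blast
  define f where "f W d = (\<Sum>i\<in>A. \<bar>\<Sum>k<n. W (i, k) * d k\<bar>)" for W :: "nat \<times> nat \<Rightarrow> real" and d
  have f0: "(\<forall>i\<in>A. (\<Sum>k<n. W (i, k) * d k) = 0) \<longleftrightarrow> f W d = 0" for W d
    using fin by (simp add: f_def sum_nonneg_eq_0_iff)
  have "(\<exists>d\<in>normalized_vecs n j. f W d = 0) \<longleftrightarrow>
        (\<forall>l. \<exists>d\<in>normalized_vecs n j \<inter> rat_vecs n. f W d < inverse (real (Suc l)))" for W
  proof safe
    fix d l assume d: "d \<in> normalized_vecs n j" "f W d = 0"
    have "(\<lambda>k. f W (rat_approx d k)) \<longlonglongrightarrow> f W d"
      unfolding f_def by (intro tendsto_intros rat_approx_tendsto)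
    then have "\<forall>\<^sub>F k in sequentially. f W (rat_approx d k) < inverse (real (Suc l))"
      by (rule order_tendstoD(2)) (simp add: d)
    then obtain k where "f W (rat_approx d k) < inverse (real (Suc l))"
      by (auto dest: eventually_happens)
    moreover have "rat_approx d k \<in> normalized_vecs n j \<inter> rat_vecs n"
      using d(1) rat_approx_in_rat_vecs[of d n k] rat_approx_eq_1[of d j k] abs_rat_approx_le_1[of d _ k]
      by (auto simp: normalized_vecs_def rat_vecs_def)
    ultimately show "\<exists>d\<in>normalized_vecs n j \<inter> rat_vecs n. f W d < inverse (real (Suc l))" by blast
  next
    assume *: "\<forall>l. \<exists>d\<in>normalized_vecs n j \<inter> rat_vecs n. f W d < inverse (real (Suc l))"
    then have "normalized_vecs n j \<noteq> {}" by auto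
    moreover have "continuous_on (normalized_vecs n j) (f W)"
      unfolding f_def
      by (intro continuous_intros continuous_on_product_then_coordinatewise continuous_on_id)
    ultimately obtain d where d: "d \<in> normalized_vecs n j" "\<And>e. e \<in> normalized_vecs n j \<Longrightarrow> f W d \<le> f W e"
      using continuous_attains_inf[OF compact_normalized_vecs] by meson
    have "f W d < inverse (real (Suc l))" for l using * d(2) by (meson Int_iff le_less_trans)
    then have "f W d \<le> 0"
      by (metis not_less reals_Archimedean less_asym)
    moreover have "f W d \<ge> 0" by (simp add: f_def sum_nonneg)
    ultimately show "\<exists>d\<in>normalized_vecs n j. f W d = 0" using d(1) by force
  qed
  moreover have "{W \<in> space (gauss_matrix m n). \<forall>l. \<exists>d\<in>normalized_vecs n j \<inter> rat_vecs n. f W d < inverse (real (Suc l))}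
     \<in> sets (gauss_matrix m n)"
  proof (intro sets.sets_Collect_countable_All sets.sets_Collect_countable_Ex')
    show "countable (normalized_vecs n j \<inter> rat_vecs n)"
      using countable_rat_vecs countable_subset by blast
    fix l d assume "d \<in> normalized_vecs n j \<inter> rat_vecs n"
    have [measurable]: "(\<lambda>W. f W d) \<in> borel_measurable (gauss_matrix m n)"
      unfolding f_def using A by (intro borel_measurable_sum borel_measurable_abs measurable_gauss_matrix_row) auto
    show "{W \<in> space (gauss_matrix m n). f W d < inverse (real (Suc l))} \<in> sets (gauss_matrix m n)"
      by measurable
  qed
  ultimately show ?thesis by (simp add: f0)
qed

lemma kernel_vector_normalize:
  "(\<exists>d\<in>vecs n. (\<exists>j<n. d j \<noteq> 0) \<and> (\<forall>i\<in>A. (\<Sum>j<n. W (i, j) * d j) = 0)) \<longleftrightarrow>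
   (\<exists>j\<in>{..<n}. \<exists>d\<in>normalized_vecs n j. \<forall>i\<in>A. (\<Sum>k<n. W (i, k) * d k) = 0)" for W :: "_ \<Rightarrow> real"
proof
  assume "\<exists>d\<in>vecs n. (\<exists>j<n. d j \<noteq> 0) \<and> (\<forall>i\<in>A. (\<Sum>j<n. W (i, j) * d j) = 0)"
  then obtain d j0 where d: "d \<in> vecs n" "j0 < n" "d j0 \<noteq> 0" "\<And>i. i \<in> A \<Longrightarrow> (\<Sum>j<n. W (i, j) * d j) = 0"
    by auto
  define M where "M = Max ((\<lambda>k. \<bar>d k\<bar>) ` {..<n})"
  have "M \<in> (\<lambda>k. \<bar>d k\<bar>) ` {..<n}" unfolding M_def using d by (intro Max_in) auto
  then obtain j where j: "j < n" "M = \<bar>d j\<bar>" by auto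
  have le: "\<bar>d k\<bar> \<le> M" if "k < n" for k unfolding M_def using that by (intro Max_ge) auto
  have "M > 0" using le[OF d(2)] d(3) by auto
  have "(\<lambda>k. d k / d j) \<in> normalized_vecs n j"
    unfolding normalized_vecs_def
  proof (intro CollectI conjI allI)
    show "\<bar>d k / d j\<bar> \<le> 1" for k
      using le[of k] d(1) j \<open>M > 0\<close> by (cases "k < n") (auto simp: vecs_def abs_divide)
  qed (use d(1) j \<open>M > 0\<close> in \<open>auto simp: vecs_def\<close>)
  moreover have "(\<Sum>k<n. W (i, k) * (d k / d j)) = 0" if "i \<in> A" for i
    using d(4)[OF that] by (simp add: sum_divide_distrib[symmetric])
  ultimately have "\<exists>d\<in>normalized_vecs n j. \<forall>i\<in>A. (\<Sum>k<n. W (i, k) * d k) = 0"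
    by (intro bexI[of _ "\<lambda>k. d k / d j"]) simp_all
  then show "\<exists>j\<in>{..<n}. \<exists>d\<in>normalized_vecs n j. \<forall>i\<in>A. (\<Sum>k<n. W (i, k) * d k) = 0"
    using j(1) by (intro bexI[of _ j]) simp_all
next
  assume "\<exists>j\<in>{..<n}. \<exists>d\<in>normalized_vecs n j. \<forall>i\<in>A. (\<Sum>k<n. W (i, k) * d k) = 0"
  then obtain j d where d: "j < n" "d \<in> normalized_vecs n j" "\<forall>i\<in>A. (\<Sum>k<n. W (i, k) * d k) = 0"
    by (metis lessThan_iff)
  moreover have "d \<in> vecs n" "d j \<noteq> 0" using d(2) by (auto simp: normalized_vecs_def)
  ultimately show "\<exists>d\<in>vecs n. (\<exists>j<n. d j \<noteq> 0) \<and> (\<forall>i\<in>A. (\<Sum>j<n. W (i, j) * d j) = 0)"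
    by blast
qed

lemma sets_gauss_matrix_kernel_event:
  assumes "A \<subseteq> {..<m}"
  shows "{W \<in> space (gauss_matrix m n). \<exists>d\<in>vecs n. (\<exists>j<n. d j \<noteq> 0) \<and> (\<forall>i\<in>A. (\<Sum>j<n. W (i, j) * d j) = 0)}
    \<in> sets (gauss_matrix m n)"
proof -
  have "{W \<in> space (gauss_matrix m n). \<exists>j\<in>{..<n}. \<exists>d\<in>normalized_vecs n j. \<forall>i\<in>A. (\<Sum>k<n. W (i, k) * d k) = 0}
    \<in> sets (gauss_matrix m n)"
    by (intro sets.sets_Collect_finite_Ex sets_gauss_matrix_normalized_kernel_event assms) auto
  then show ?thesis unfolding kernel_vector_normalize .
qed

lemma sets_gauss_matrix_inj [measurable]:
  "{W \<in> space (gauss_matrix m n). inj_on (relu_layer m n W) (vecs n)} \<in> sets (gauss_matrix m n)"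
proof -
  have "{W \<in> space (gauss_matrix m n). \<exists>A\<in>Pow {..<m}.
      (\<exists>d\<in>vecs n. (\<exists>j<n. d j \<noteq> 0) \<and> (\<forall>i\<in>A. (\<Sum>j<n. W (i, j) * d j) = 0)) \<and>
      (\<exists>z\<in>vecs n. \<forall>i\<in>{..<m} - A. (\<Sum>j<n. W (i, j) * z j) < 0)} \<in> sets (gauss_matrix m n)"
    by (intro sets.sets_Collect_finite_Ex sets.sets_Collect_conj
        sets_gauss_matrix_kernel_event sets_gauss_matrix_neg_event) auto
  from sets.sets_Collect_neg[OF this] show ?thesis
    unfolding inj_relu_layer_iff by (simp add: Bex_def)
qed

subsection \<open>General position\<close>

lemma emeasure_std_gauss_singleton: "emeasure std_gauss {p} = 0"
proof -
  have "{p} \<in> null_sets std_gauss"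
    by (subst null_sets_density_iff, simp, intro conjI, simp, rule AE_mp[OF AE_lborel_singleton[of p]]) simp
  then show ?thesis by auto
qed

text \<open>By Fubini in coordinate \<open>l\<close>: once the other coordinates are fixed, the
  equation determines \<open>y l\<close>, because \<open>u l\<close> is nonzero, and a single point
  has Gaussian measure zero.\<close>

lemma emeasure_gauss_hyperplane:
  assumes "finite L" "l \<in> L" "u l \<noteq> (0::real)"
  shows "emeasure (PiM L (\<lambda>_. std_gauss)) {y \<in> space (PiM L (\<lambda>_. std_gauss)). (\<Sum>k\<in>L. u k * y k) = 0} = 0"
    (is "emeasure ?P ?S = 0")
proof -
  interpret product_prob_space "\<lambda>_. std_gauss" by (rule product_prob_space_std_gauss)
  define L' where "L' = L - {l}"
  have L: "L = insert l L'" "l \<notin> L'" "finite L'" using assms by (auto simp: L'_def)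
  have [measurable]: "(\<lambda>y. y k) \<in> borel_measurable ?P" if "k \<in> L" for k
    using measurable_component_singleton[OF that, of "\<lambda>_. std_gauss"] by simp
  have [measurable]: "(\<lambda>y. \<Sum>k\<in>L. u k * y k) \<in> borel_measurable ?P"
    by (intro borel_measurable_sum) auto
  have [measurable]: "?S \<in> sets ?P" by measurable
  have "emeasure ?P ?S = (\<integral>\<^sup>+ y. indicator ?S y \<partial>?P)" by simp
  also have "\<dots> = (\<integral>\<^sup>+ x. (\<integral>\<^sup>+ y. indicator ?S (x(l := y)) \<partial>std_gauss) \<partial>(PiM L' (\<lambda>_. std_gauss)))"
    unfolding L(1) by (rule product_nn_integral_insert) (use L in \<open>auto simp flip: L(1)\<close>)
  also have "\<dots> = (\<integral>\<^sup>+ x. 0 \<partial>(PiM L' (\<lambda>_. std_gauss)))"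
  proof (rule nn_integral_cong)
    fix x
    define p where "p = - (\<Sum>k\<in>L'. u k * x k) / u l"
    have "indicator ?S (x(l := y)) \<le> (indicator {p} y :: ennreal)" for y
    proof (cases "x(l := y) \<in> ?S")
      case True
      then have "(\<Sum>k\<in>L. u k * (x(l := y)) k) = 0" by auto
      moreover have "(\<Sum>k\<in>L. u k * (x(l := y)) k) = u l * y + (\<Sum>k\<in>L'. u k * x k)"
        unfolding L(1) using L by (simp, intro sum.cong) auto
      ultimately have "y = p" using assms by (simp add: p_def field_simps)
      then show ?thesis by (simp add: indicator_def)
    qed simp
    then have "(\<integral>\<^sup>+ y. indicator ?S (x(l := y)) \<partial>std_gauss) \<le> (\<integral>\<^sup>+ y. indicator {p} y \<partial>std_gauss)"
      by (rule nn_integral_mono)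
    also have "\<dots> = 0" by (simp add: emeasure_std_gauss_singleton)
    finally show "(\<integral>\<^sup>+ y. indicator ?S (x(l := y)) \<partial>std_gauss) = 0" by simp
  qed
  finally show ?thesis by simp
qed

text \<open>If column \<open>j\<close> of a singular square block is a combination of the other columns, it lies in a
  hyperplane that depends on those columns only.\<close>

lemma emeasure_gauss_matrix_normalized_kernel:
  assumes A: "A \<subseteq> {..<m}" "card A = n" and j: "j < n"
  shows "emeasure (gauss_matrix m n)
    {W \<in> space (gauss_matrix m n). \<exists>d\<in>normalized_vecs n j. \<forall>i\<in>A. (\<Sum>k<n. W (i, k) * d k) = 0} = 0"
    (is "emeasure _ ?S = 0")
proof -
  interpret product_prob_space "\<lambda>_. std_gauss" by (rule product_prob_space_std_gauss)
  have finA: "finite A" using A finite_subset by blast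
  \<comment> \<open>Fubini separates the entries of column \<open>j\<close> in the rows
    \<open>A\<close>, indexed by \<open>I2\<close>, from all remaining entries, which are held fixed
    as \<open>x\<close>.\<close>
  define I1 where "I1 = {..<m} \<times> {..<n} - A \<times> {j}"
  define I2 where "I2 = A \<times> {j}"
  have I: "I1 \<union> I2 = {..<m} \<times> {..<n}" "I1 \<inter> I2 = {}" "finite I1" "finite I2"
    using A j finA by (auto simp: I1_def I2_def)
  let ?G = "\<lambda>I. PiM I (\<lambda>_. std_gauss)"
  have S: "?S \<in> sets (?G (I1 \<union> I2))"
    unfolding I using sets_gauss_matrix_normalized_kernel_event[OF A(1), of n j]
    by (simp add: gauss_matrix_def)
  have "emeasure (gauss_matrix m n) ?S = (\<integral>\<^sup>+ W. indicator ?S W \<partial>?G (I1 \<union> I2))"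
    using S by (simp add: gauss_matrix_def I)
  also have "\<dots> = (\<integral>\<^sup>+ x. (\<integral>\<^sup>+ y. indicator ?S (merge I1 I2 (x, y)) \<partial>?G I2) \<partial>?G I1)"
    by (rule product_nn_integral_fold) (use I S in auto)
  also have "\<dots> = (\<integral>\<^sup>+ x. 0 \<partial>?G I1)"
  proof (rule nn_integral_cong)
    fix x :: "nat \<times> nat \<Rightarrow> real"
    \<comment> \<open>The \<open>n - 1\<close> columns other than \<open>j\<close> cannot span the
      space of dimension \<open>card A = n\<close>, so some nonzero \<open>u\<close>, determined by
      \<open>x\<close> alone, is orthogonal to all of them.\<close>
    have "card ({..<n} - {j}) < card A" using A j by simp
    then have "\<exists>u. (\<forall>i. i \<notin> A \<longrightarrow> u i = 0) \<and> (\<exists>i\<in>A. u i \<noteq> 0) \<and>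
        (\<forall>k\<in>{..<n} - {j}. (\<Sum>i\<in>A. x (i, k) * u i) = 0)"
      by (intro underdetermined_system_nontrivial_solution finA) simp
    then obtain u where u0: "\<exists>i\<in>A. u i \<noteq> 0" "\<forall>k\<in>{..<n} - {j}. (\<Sum>i\<in>A. x (i, k) * u i) = 0"
      by (elim exE conjE)
    then obtain i0 where u: "i0 \<in> A" "u i0 \<noteq> 0" by blast
    let ?H = "{y \<in> space (?G I2). (\<Sum>p\<in>I2. u (fst p) * y p) = 0}"
    have "(\<integral>\<^sup>+ y. indicator ?S (merge I1 I2 (x, y)) \<partial>?G I2) \<le> (\<integral>\<^sup>+ y. indicator ?H y \<partial>?G I2)"
    proof (rule nn_integral_mono)
      fix y assume y: "y \<in> space (?G I2)"
      show "indicator ?S (merge I1 I2 (x, y)) \<le> (indicator ?H y :: ennreal)"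
      proof (cases "merge I1 I2 (x, y) \<in> ?S")
        case True
        define W where "W = merge I1 I2 (x, y)"
        obtain d where d: "d \<in> normalized_vecs n j" "\<And>i. i \<in> A \<Longrightarrow> (\<Sum>k<n. W (i, k) * d k) = 0"
          using True by (auto simp: W_def)
        have W1: "W (i, k) = x (i, k)" if "i \<in> A" "k < n" "k \<noteq> j" for i k
          using that A I(2) by (auto simp: W_def merge_def I1_def)
        have W2: "W (i, j) = y (i, j)" if "i \<in> A" for i
          using that I(2) by (auto simp: W_def merge_def I1_def I2_def)
        \<comment> \<open>Pairing the kernel equations with \<open>u\<close> removes every column
          but \<open>j\<close>. As \<open>d j = 1\<close>, column \<open>j\<close> must then lie in
          the hyperplane orthogonal to \<open>u\<close>.\<close>
        have "0 = (\<Sum>i\<in>A. u i * (\<Sum>k<n. W (i, k) * d k))" using d by simp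
        also have "\<dots> = (\<Sum>k<n. d k * (\<Sum>i\<in>A. W (i, k) * u i))"
          by (subst sum_distrib_left, subst sum.swap) (simp add: sum_distrib_left mult_ac)
        also have "\<dots> = d j * (\<Sum>i\<in>A. W (i, j) * u i) + (\<Sum>k\<in>{..<n} - {j}. d k * (\<Sum>i\<in>A. W (i, k) * u i))"
          using j by (subst sum.remove[of _ j]) auto
        also have "(\<Sum>k\<in>{..<n} - {j}. d k * (\<Sum>i\<in>A. W (i, k) * u i)) = 0"
          using u0(2) W1 by (intro sum.neutral) simp
        also have "d j = 1" using d(1) by (simp add: normalized_vecs_def)
        also have "(\<Sum>i\<in>A. W (i, j) * u i) = (\<Sum>p\<in>I2. u (fst p) * y p)"
          unfolding I2_def 
          by (intro sum.reindex_bij_witness[of _ fst "\<lambda>i. (i, j)"]) (use W2 in auto)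
        finally have "y \<in> ?H" using y by simp
        then show ?thesis by (simp add: indicator_def)
      qed simp
    qed
    also have "\<dots> = emeasure (?G I2) ?H"
    proof (rule nn_integral_indicator)
      have [measurable]: "(\<lambda>y. y k) \<in> borel_measurable (?G I2)" if "k \<in> I2" for k
        using measurable_component_singleton[OF that, of "\<lambda>_. std_gauss"] by simp
      have [measurable]: "(\<lambda>y. \<Sum>p\<in>I2. u (fst p) * y p) \<in> borel_measurable (?G I2)"
        by (intro borel_measurable_sum) auto
      show "?H \<in> sets (?G I2)" by measurable
    qed
    also have "\<dots> = 0"
      by (rule emeasure_gauss_hyperplane[of I2 "(i0, j)"]) (use u I in \<open>auto simp: I2_def\<close>)
    finally show "(\<integral>\<^sup>+ y. indicator ?S (merge I1 I2 (x, y)) \<partial>?G I2) = 0" by simp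
  qed
  finally show ?thesis by simp
qed

text \<open>There are finitely many row sets \<open>A\<close> and finitely many indices
  \<open>j\<close> of a normalised coordinate, and each pair contributes a null set.\<close>

lemma AE_gauss_matrix_general_position:
  "AE W in gauss_matrix m n. \<forall>A\<subseteq>{..<m}. card A = n \<longrightarrow>
     \<not> (\<exists>d\<in>vecs n. (\<exists>j<n. d j \<noteq> 0) \<and> (\<forall>i\<in>A. (\<Sum>j<n. W (i, j) * d j) = 0))"
proof -
  have "AE W in gauss_matrix m n. \<not> (\<exists>d\<in>normalized_vecs n j. \<forall>i\<in>A. (\<Sum>k<n. W (i, k) * d k) = 0)"
    if "A \<subseteq> {..<m}" "card A = n" "j < n" for A j
    by (rule AE_I[OF _ emeasure_gauss_matrix_normalized_kernel[OF that]
          sets_gauss_matrix_normalized_kernel_event[OF that(1)]]) auto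
  then have "AE W in gauss_matrix m n. \<forall>A\<in>{A\<in>Pow {..<m}. card A = n}. \<forall>j\<in>{..<n}.
     \<not> (\<exists>d\<in>normalized_vecs n j. \<forall>i\<in>A. (\<Sum>k<n. W (i, k) * d k) = 0)"
    by (intro AE_finite_allI) auto
  then show ?thesis
  proof (rule AE_mp, intro AE_I2 impI allI)
    fix W A assume *: "\<forall>A\<in>{A\<in>Pow {..<m}. card A = n}. \<forall>j\<in>{..<n}.
     \<not> (\<exists>d\<in>normalized_vecs n j. \<forall>i\<in>A. (\<Sum>k<n. W (i, k) * d k) = 0)" and "A \<subseteq> {..<m}" "card A = n"
    then show "\<not> (\<exists>d\<in>vecs n. (\<exists>j<n. d j \<noteq> 0) \<and> (\<forall>i\<in>A. (\<Sum>j<n. W (i, j) * d j) = 0))"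
      unfolding kernel_vector_normalize by blast
  qed
qed

subsection \<open>Wendel's bound\<close>

lemma distr_std_gauss_sign:
  assumes "e = 1 \<or> e = (-1::real)"
  shows "distr std_gauss std_gauss (\<lambda>x. e * x) = std_gauss"
proof (rule measure_eqI)
  fix A assume "A \<in> sets (distr std_gauss std_gauss (\<lambda>x. e * x))"
  then have A [measurable]: "A \<in> sets borel" by simp
  have "(\<lambda>x. e * x) -` A \<inter> space borel \<in> sets borel"
    by (rule measurable_sets[OF _ A]) simp
  then have [measurable]: "(\<lambda>x. e * x) -` A \<in> sets borel" by simp
  have "emeasure (distr std_gauss std_gauss (\<lambda>x. e * x)) A = (\<integral>\<^sup>+ x. std_normal_density x * indicator A (e * x) \<partial>lborel)"
    by (subst emeasure_distr, simp, simp)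
      (auto simp: emeasure_density indicator_def ennreal_mult' intro!: nn_integral_cong)
  also have "\<dots> = (\<integral>\<^sup>+ x. std_normal_density (e * x) * indicator A (e * x) \<partial>lborel)"
    using assms by (intro nn_integral_cong) (auto simp: std_normal_density_def)
  also have "\<dots> = (\<integral>\<^sup>+ x. std_normal_density x * indicator A x \<partial>distr lborel borel (\<lambda>x. e * x))"
    by (subst nn_integral_distr) auto
  also have "distr lborel borel (\<lambda>x. e * x) = lborel"
    using assms lborel_distr_uminus by (auto simp: distr_id2)
  finally show "emeasure (distr std_gauss std_gauss (\<lambda>x. e * x)) A = emeasure std_gauss A"
    by (simp add: emeasure_density ennreal_mult' ennreal_indicator)
qed simp

lemma distr_PiM_gauss_signs:
  assumes "finite L" "\<And>k. k \<in> L \<Longrightarrow> e k = 1 \<or> e k = (-1::real)"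
  shows "distr (PiM L (\<lambda>_. std_gauss)) (PiM L (\<lambda>_. std_gauss)) (\<lambda>x. \<lambda>k\<in>L. e k * x k) = PiM L (\<lambda>_. std_gauss)"
proof -
  interpret product_prob_space "\<lambda>_. std_gauss" by (rule product_prob_space_std_gauss)
  have [measurable]: "(\<lambda>x. \<lambda>k\<in>L. e k * x k) \<in> PiM L (\<lambda>_. std_gauss) \<rightarrow>\<^sub>M PiM L (\<lambda>_. std_gauss)"
  proof (rule measurable_restrict)
    fix k assume "k \<in> L"
    from measurable_component_singleton[OF this, of "\<lambda>_. std_gauss"]
    show "(\<lambda>x. e k * x k) \<in> PiM L (\<lambda>_. std_gauss) \<rightarrow>\<^sub>M std_gauss" by simp
  qed
  show ?thesis
  proof (rule PiM_eqI)
    fix A assume A: "\<And>i. i \<in> L \<Longrightarrow> A i \<in> sets std_gauss"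
    have "(\<lambda>x. \<lambda>k\<in>L. e k * x k) -` Pi\<^sub>E L A \<inter> space (PiM L (\<lambda>_. std_gauss)) = (\<Pi>\<^sub>E k\<in>L. (\<lambda>x. e k * x) -` A k)"
      by (auto simp: space_PiM PiE_iff)
    then have "emeasure (distr (PiM L (\<lambda>_. std_gauss)) (PiM L (\<lambda>_. std_gauss)) (\<lambda>x. \<lambda>k\<in>L. e k * x k)) (Pi\<^sub>E L A)
      = emeasure (PiM L (\<lambda>_. std_gauss)) (\<Pi>\<^sub>E k\<in>L. (\<lambda>x. e k * x) -` A k)"
      using A assms(1) by (subst emeasure_distr) auto
    also have "\<dots> = (\<Prod>k\<in>L. emeasure std_gauss ((\<lambda>x. e k * x) -` A k))"
    proof (rule emeasure_PiM[OF assms(1)])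
      fix k assume "k \<in> L"
      then have "A k \<in> sets borel" using A by simp
      then have "(\<lambda>x. e k * x) -` A k \<inter> space borel \<in> sets borel"
        by (intro measurable_sets) auto
      then show "(\<lambda>x. e k * x) -` A k \<in> sets std_gauss" by simp
    qed
    also have "\<dots> = (\<Prod>k\<in>L. emeasure std_gauss (A k))"
    proof (rule prod.cong)
      fix k assume k: "k \<in> L"
      have "emeasure std_gauss (A k) = emeasure (distr std_gauss std_gauss (\<lambda>x. e k * x)) (A k)"
        using distr_std_gauss_sign[OF assms(2)[OF k]] by simp
      also have "\<dots> = emeasure std_gauss ((\<lambda>x. e k * x) -` A k)"
        using A[OF k] by (subst emeasure_distr) auto
      finally show "emeasure std_gauss ((\<lambda>x. e k * x) -` A k) = emeasure std_gauss (A k)" by simp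
    qed simp
    finally show "emeasure (distr (PiM L (\<lambda>_. std_gauss)) (PiM L (\<lambda>_. std_gauss)) (\<lambda>x. \<lambda>k\<in>L. e k * x k)) (Pi\<^sub>E L A)
      = (\<Prod>i\<in>L. emeasure std_gauss (A i))" .
  qed (use assms in auto)
qed

text \<open>Double counting. For each \<open>U \<subseteq> T\<close>, negating the rows outside
  \<open>U\<close> preserves the law, so all events \<open>F U\<close> have the same probability.
  For a fixed \<open>W\<close>, membership in \<open>F U\<close> forces \<open>U\<close> to be
  exactly the set of rows of \<open>T\<close> on which some linear functional is negative, so
  \<open>W\<close> lies in at most as many \<open>F U\<close> as there are sign patterns. Taking
  expectations bounds \<open>2 ^ card T\<close> copies of the probability.\<close>

lemma prob_gauss_matrix_rows_in_halfspace_le: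
  assumes T: "T \<subseteq> {..<m}"
  shows "measure (gauss_matrix m n)
      {W \<in> space (gauss_matrix m n). \<exists>z\<in>vecs n. \<forall>i\<in>T. (\<Sum>j<n. W (i, j) * z j) < 0}
    \<le> (\<Sum>k\<le>n. real (card T choose k)) / 2 ^ card T"
proof -
  interpret prob_space "gauss_matrix m n" by (rule prob_space_gauss_matrix)
  have fin: "finite T" using T finite_subset by blast
  let ?G = "gauss_matrix m n"
  let ?s = "\<lambda>W i z. \<Sum>j<n. W (i, j) * z j"
  define E where "E = {W \<in> space ?G. \<exists>z\<in>vecs n. \<forall>i\<in>T. ?s W i z < 0}"
  have E [measurable]: "E \<in> sets ?G" unfolding E_def by (rule sets_gauss_matrix_neg_event[OF T])
  define e where "e U i = (if i \<in> U then 1 else -1 :: real)" for U :: "nat set" and i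
  define flip where "flip U W = (\<lambda>p\<in>{..<m} \<times> {..<n}. e U (fst p) * W p)" for U and W :: "nat \<times> nat \<Rightarrow> real"
  have distr_flip: "distr ?G ?G (flip U) = ?G" for U
    unfolding gauss_matrix_def flip_def by (rule distr_PiM_gauss_signs) (auto simp: e_def)
  have flip_meas [measurable]: "flip U \<in> ?G \<rightarrow>\<^sub>M ?G" for U
    unfolding gauss_matrix_def flip_def
  proof (rule measurable_restrict)
    fix k :: "nat \<times> nat" assume "k \<in> {..<m} \<times> {..<n}"
    from measurable_component_singleton[OF this, of "\<lambda>_. std_gauss"]
    show "(\<lambda>W. e U (fst k) * W k) \<in> PiM ({..<m} \<times> {..<n}) (\<lambda>_. std_gauss) \<rightarrow>\<^sub>M std_gauss" by simp
  qed
  define F where "F U = flip U -` E \<inter> space ?G" for U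
  have F [measurable]: "F U \<in> sets ?G" for U unfolding F_def by measurable
  have prob_F: "prob (F U) = prob E" for U
  proof -
    have "prob E = measure (distr ?G ?G (flip U)) E" by (simp add: distr_flip)
    also have "\<dots> = prob (F U)" unfolding F_def by (rule measure_distr) measurable
    finally show ?thesis by simp
  qed
  have pattern: "U \<in> {{i\<in>T. ?s W i x < 0} |x. x \<in> vecs n}" if W: "W \<in> F U" and U: "U \<subseteq> T" for U W
  proof -
    obtain z where z: "z \<in> vecs n" "\<And>i. i \<in> T \<Longrightarrow> ?s (flip U W) i z < 0"
      using W by (auto simp: F_def E_def)
    have "?s (flip U W) i z = e U i * ?s W i z" if "i \<in> T" for i
      unfolding sum_distrib_left using that T
      by (intro sum.cong) (auto simp: flip_def)
    with z(2) have "e U i * ?s W i z < 0" if "i \<in> T" for i using that by simp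
    then have "U = {i\<in>T. ?s W i z < 0}" using U by (force simp: e_def split: if_splits)
    then show ?thesis using z(1) by blast
  qed
  have "2 ^ card T * prob E = (\<Sum>U\<in>Pow T. prob (F U))"
    using fin by (simp add: prob_F card_Pow)
  also have "\<dots> = (\<Sum>U\<in>Pow T. expectation (indicator (F U)))" by simp
  also have "\<dots> = expectation (\<lambda>W. \<Sum>U\<in>Pow T. indicator (F U) W)"
    by (rule Bochner_Integration.integral_sum[symmetric]) (auto simp: emeasure_eq_measure)
  also have "\<dots> \<le> expectation (\<lambda>W. (\<Sum>k\<le>n. real (card T choose k)))"
  proof (rule integral_mono)
    show "integrable ?G (\<lambda>W. \<Sum>U\<in>Pow T. indicator (F U) W :: real)"
      by (intro Bochner_Integration.integrable_sum) (auto simp: emeasure_eq_measure)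
    fix W assume "W \<in> space ?G"
    have "(\<Sum>U\<in>Pow T. indicator (F U) W :: real) = real (card {U\<in>Pow T. W \<in> F U})"
      using fin by (simp add: indicator_def sum.If_cases Int_def)
    also have "\<dots> \<le> real (card {{i\<in>T. ?s W i x < 0} |x. x \<in> vecs n})"
    proof (intro of_nat_mono card_mono)
      show "finite {{i\<in>T. ?s W i x < 0} |x. x \<in> vecs n}"
        by (rule finite_subset[of _ "Pow T"]) (use fin in auto)
      show "{U\<in>Pow T. W \<in> F U} \<subseteq> {{i\<in>T. ?s W i x < 0} |x. x \<in> vecs n}"
        using pattern by blast
    qed
    also have "\<dots> \<le> real (\<Sum>k\<le>n. card T choose k)"
      by (intro of_nat_mono card_sign_patterns_le fin)
    finally show "(\<Sum>U\<in>Pow T. indicator (F U) W) \<le> (\<Sum>k\<le>n. real (card T choose k))" by simp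
  qed simp
  finally show ?thesis unfolding E_def using prob_space by (simp add: field_simps)
qed

subsection \<open>Many rows\<close>

text \<open>The first factor bounds the number of candidate row sets, the second the probability
  that one of them lies in an open half-space. Both come from \<open>sum_binomial_le\<close> with
  \<open>t = 1/10\<close>.\<close>

lemma prob_not_inj_le:
  assumes "n \<le> m" "0 < n"
  shows "1 - inj_prob m n \<le> ((11/10) ^ m * 10 ^ n) * ((11/20) ^ (m - n) * 10 ^ n)"
proof -
  interpret prob_space "gauss_matrix m n" by (rule prob_space_gauss_matrix)
  let ?G = "gauss_matrix m n"
  \<comment> \<open>In general position at most \<open>n - 1\<close> rows are orthogonal to a
    nonzero vector, so at least this many rows remain for the half-space.\<close>
  define N where "N = m - n + 1"
  have N: "N \<le> m" using assms by (simp add: N_def)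
  define \<T> where "\<T> = {T. T \<subseteq> {..<m} \<and> card T = N}"
  have fin: "finite \<T>" by (rule finite_subset[of _ "Pow {..<m}"]) (auto simp: \<T>_def)
  define E where "E T = {W \<in> space ?G. \<exists>z\<in>vecs n. \<forall>i\<in>T. (\<Sum>j<n. W (i, j) * z j) < 0}" for T
  have E [measurable]: "E T \<in> sets ?G" if "T \<in> \<T>" for T
    unfolding E_def using that by (intro sets_gauss_matrix_neg_event) (auto simp: \<T>_def)
  let ?inj = "{W \<in> space ?G. inj_on (relu_layer m n W) (vecs n)}"
  have "1 - inj_prob m n = prob (space ?G - ?inj)"
    unfolding inj_prob_def by (rule prob_compl[symmetric]) measurable
  also have "\<dots> \<le> prob (\<Union>T\<in>\<T>. E T)"
  proof (rule finite_measure_mono_AE)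
    show "AE W in ?G. W \<in> space ?G - ?inj \<longrightarrow> W \<in> (\<Union>T\<in>\<T>. E T)"
      using AE_gauss_matrix_general_position[of m n]
    proof (rule AE_mp, intro AE_I2 impI)
      fix W assume W: "W \<in> space ?G" "W \<in> space ?G - ?inj"
       and gp: "\<forall>A\<subseteq>{..<m}. card A = n \<longrightarrow>
         \<not> (\<exists>d\<in>vecs n. (\<exists>j<n. d j \<noteq> 0) \<and> (\<forall>i\<in>A. (\<Sum>j<n. W (i, j) * d j) = 0))"
      obtain A where A: "A \<subseteq> {..<m}" "\<exists>d\<in>vecs n. (\<exists>j<n. d j \<noteq> 0) \<and> (\<forall>i\<in>A. (\<Sum>j<n. W (i, j) * d j) = 0)"
        "\<exists>z\<in>vecs n. \<forall>i\<in>{..<m} - A. (\<Sum>j<n. W (i, j) * z j) < 0"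
        using W inj_relu_layer_iff[of m n W] by blast
      have finA: "finite A" using A(1) finite_subset by blast
      have "card A < n"
      proof (rule ccontr)
        assume "\<not> card A < n"
        then obtain B where B: "B \<subseteq> A" "card B = n"
          using obtain_subset_with_card_n[of n A] by (metis not_less)
        then have "B \<subseteq> {..<m}" using A(1) by blast
        with gp B(2) have "\<not> (\<exists>d\<in>vecs n. (\<exists>j<n. d j \<noteq> 0) \<and> (\<forall>i\<in>B. (\<Sum>j<n. W (i, j) * d j) = 0))" by blast
        then show False using A(2) B(1) by (meson subsetD)
      qed
      then have "N \<le> card ({..<m} - A)"
        using A(1) finA assms by (subst card_Diff_subset) (auto simp: N_def)
      then obtain T where T: "T \<subseteq> {..<m} - A" "card T = N"
        using obtain_subset_with_card_n by metis
      have "T \<in> \<T>" using T by (auto simp: \<T>_def)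
      moreover have "W \<in> E T" using A(3) T(1) W(1) unfolding E_def by blast
      ultimately show "W \<in> (\<Union>T\<in>\<T>. E T)" by blast
    qed
    show "(\<Union>T\<in>\<T>. E T) \<in> sets ?G" by (intro sets.finite_UN) (use fin E in auto)
  qed
  also have "\<dots> \<le> (\<Sum>T\<in>\<T>. prob (E T))"
    by (rule finite_measure_subadditive_finite) (use fin E in auto)
  also have "\<dots> \<le> (\<Sum>T\<in>\<T>. (\<Sum>k\<le>n. real (N choose k)) / 2 ^ N)"
    unfolding E_def
    by (intro sum_mono order.trans[OF prob_gauss_matrix_rows_in_halfspace_le]) (auto simp: \<T>_def)
  \<comment> \<open>Choosing \<open>N\<close> rows amounts to omitting \<open>n - 1\<close> of them;
    in this form the coefficient is a single term of a sum over \<open>k \<le> n\<close>.\<close>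
  also have "\<dots> = real (m choose (n - 1)) * ((\<Sum>k\<le>n. real (N choose k)) / 2 ^ N)"
    using N assms n_subsets[of "{..<m}" N] binomial_symmetric[of N m] by (simp add: \<T>_def N_def)
  also have "\<dots> \<le> ((11/10) ^ m * 10 ^ n) * ((11/20) ^ N * 10 ^ n)"
  proof (rule mult_mono)
    have b: "(\<Sum>k\<le>n. real (M choose k)) \<le> (11/10) ^ M * 10 ^ n" for M
      using sum_binomial_le[of "1/10" M n] by (simp add: power_divide)
    have "real (m choose (n - 1)) \<le> (\<Sum>k\<le>n. real (m choose k))"
      by (rule member_le_sum) auto
    then show "real (m choose (n - 1)) \<le> (11/10) ^ m * 10 ^ n" using b[of m] by simp
    have "(11/20) ^ N = (11/10) ^ N / (2::real) ^ N" by (simp flip: power_divide)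
    then show "(\<Sum>k\<le>n. real (N choose k)) / 2 ^ N \<le> (11/20) ^ N * 10 ^ n"
      using b[of N] by (simp add: divide_right_mono)
  qed (auto intro!: divide_nonneg_nonneg sum_nonneg)
  also have "\<dots> \<le> ((11/10) ^ m * 10 ^ n) * ((11/20) ^ (m - n) * 10 ^ n)"
    by (intro mult_left_mono mult_right_mono power_decreasing) (auto simp: N_def)
  finally show ?thesis by simp
qed

lemma inj_prob_tendsto_1:
  assumes "\<forall>\<^sub>F n in sequentially. 10.4 * real n \<le> real (m n)"
  shows "(\<lambda>n. inj_prob (m n) n) \<longlonglongrightarrow> 1"
proof -
  \<comment> \<open>With \<open>m = 10.4 * n\<close> the bound is the \<open>n\<close>-th power of
    this number: \<open>605/1000\<close> is \<open>11/10 * 11/20\<close>, and \<open>2000/11\<close>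
    is \<open>10 * (20/11) * 10\<close>, where \<open>20/11\<close> compensates for the exponent
    \<open>m - n\<close>.\<close>
  define \<rho> :: real where "\<rho> = (605/1000) powr 10.4 * (2000/11)"
  \<comment> \<open>The fifth power turns the exponent 10.4 into the integer 52, so that the
    comparison with 1 becomes exact rational arithmetic.\<close>
  have "\<rho> ^ 5 = ((605/1000) powr 10.4) ^ 5 * (2000/11) ^ 5" by (simp add: \<rho>_def power_mult_distrib power_divide)
  also have "((605/1000::real) powr 10.4) ^ 5 = (605/1000) powr (real 52)"
    by (subst powr_power) auto
  also have "\<dots> = (605/1000) ^ 52" by (subst powr_realpow) auto
  also have "(605/1000) ^ 52 * (2000/11) ^ 5 < (1 :: real) ^ 5" by (simp add: field_simps)
  finally have \<rho>: "\<rho> < 1" by (rule power_less_imp_less_base) simp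
  have \<rho>0: "\<rho> \<ge> 0" by (simp add: \<rho>_def)
  have bound: "1 - inj_prob (m n) n \<le> \<rho> ^ n" if mn: "10.4 * real n \<le> real (m n)" and "0 < n" for n
  proof -
    have nm: "n \<le> m n" using mn by linarith
    have "1 - inj_prob (m n) n \<le> ((11/10) ^ m n * 10 ^ n) * ((11/20) ^ (m n - n) * 10 ^ n)"
      using prob_not_inj_le[OF nm \<open>0 < n\<close>] by simp
    also have "(11/20) ^ (m n - n) = (11/20) ^ m n * (20/11 :: real) ^ n"
      using nm by (simp add: power_diff power_divide)
    also have "((11/10) ^ m n * 10 ^ n) * ((11/20) ^ m n * (20/11) ^ n * 10 ^ n) = 
      ((11/10) * (11/20)) ^ m n * (10 * (20/11) * 10 :: real) ^ n"
      by (simp only: power_mult_distrib mult_ac)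
    also have "\<dots> = (605/1000) powr (real (m n)) * (2000/11) ^ n"
      by (simp add: powr_realpow)
    also have "\<dots> \<le> (605/1000) powr (10.4 * real n) * (2000/11) ^ n"
      by (intro mult_right_mono powr_mono') (use mn in auto)
    also have "\<dots> = \<rho> ^ n"
      unfolding \<rho>_def power_mult_distrib by (subst powr_power) (auto simp: mult.commute)
    finally show ?thesis .
  qed
  have "(\<lambda>n. 1 - \<rho> ^ n) \<longlonglongrightarrow> 1 - 0"
    using \<rho> \<rho>0 by (intro tendsto_intros LIMSEQ_realpow_zero) auto
  then have lim: "(\<lambda>n. 1 - \<rho> ^ n) \<longlonglongrightarrow> 1" by simp
  show ?thesis
  proof (rule tendsto_sandwich[OF _ _ lim tendsto_const])
    show "\<forall>\<^sub>F n in sequentially. 1 - \<rho> ^ n \<le> inj_prob (m n) n"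
      using assms eventually_gt_at_top[of 0] by eventually_elim (use bound in force)
    show "\<forall>\<^sub>F n in sequentially. inj_prob (m n) n \<le> 1"
      unfolding inj_prob_def by (intro always_eventually allI prob_space.prob_le_1 prob_space_gauss_matrix)
  qed
qed

subsection \<open>Monotonicity in the number of rows\<close>

text \<open>The first \<open>m\<close> rows of a Gaussian matrix form a Gaussian matrix, and if
  these outputs already separate inputs then so do all \<open>M\<close> outputs. This reduces the
  few-rows regime to a single choice of \<open>m\<close> for each \<open>n\<close>.\<close>

lemma inj_prob_mono:
  assumes "m \<le> M"
  shows "inj_prob m n \<le> inj_prob M n"
proof -
  interpret product_prob_space "\<lambda>_. std_gauss" "{..<M} \<times> {..<n}" by (rule product_prob_space_std_gauss)
  interpret G: prob_space "gauss_matrix M n" by (rule prob_space_gauss_matrix)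
  define R where "R W = restrict W ({..<m} \<times> {..<n})" for W :: "nat \<times> nat \<Rightarrow> real"
  have R: "R \<in> gauss_matrix M n \<rightarrow>\<^sub>M gauss_matrix m n"
    unfolding R_def gauss_matrix_def by (rule measurable_restrict_subset) (use assms in auto)
  have D: "distr (gauss_matrix M n) (gauss_matrix m n) R = gauss_matrix m n"
    unfolding R_def gauss_matrix_def by (rule distr_PiM_restrict_finite) (use assms in auto)
  let ?S = "\<lambda>m. {W \<in> space (gauss_matrix m n). inj_on (relu_layer m n W) (vecs n)}"
  have "inj_prob m n = measure (distr (gauss_matrix M n) (gauss_matrix m n) R) (?S m)"
    by (simp add: inj_prob_def D)
  also have "\<dots> = measure (gauss_matrix M n) (R -` ?S m \<inter> space (gauss_matrix M n))"
    by (rule measure_distr[OF R]) measurable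
  also have "\<dots> \<le> measure (gauss_matrix M n) (?S M)"
  proof (rule G.finite_measure_mono)
    show "R -` ?S m \<inter> space (gauss_matrix M n) \<subseteq> ?S M"
    proof safe
      fix W assume W: "R W \<in> space (gauss_matrix m n)" "inj_on (relu_layer m n (R W)) (vecs n)"
      show "inj_on (relu_layer M n W) (vecs n)"
      proof (rule inj_onI)
        fix x y assume xy: "x \<in> vecs n" "y \<in> vecs n" "relu_layer M n W x = relu_layer M n W y"
        have "relu_layer m n (R W) z = (\<lambda>i. if i < m then relu_layer M n W z i else 0)" for z
          using assms by (auto simp: relu_layer_def R_def fun_eq_iff intro!: arg_cong[of _ _ ReLU] sum.cong)
        then have "relu_layer m n (R W) x = relu_layer m n (R W) y" by (simp add: xy(3) cong: if_cong)
        then show "x = y" using W(2) xy by (auto simp: inj_on_def)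
      qed
    qed
  qed measurable
  finally show ?thesis by (simp add: inj_prob_def)
qed

subsection \<open>Splitting off the column means\<close>

lemma product_sigma_finite_lborel: "product_sigma_finite (\<lambda>_. lborel :: real measure)"
  by (simp add: product_sigma_finite_def sigma_finite_lborel)

lemma borel_measurable_PiM_lborel_component:
  "k \<in> L \<Longrightarrow> (\<lambda>x. x k) \<in> borel_measurable (PiM L (\<lambda>_. lborel :: real measure))"
  using measurable_component_singleton[of k L "\<lambda>_. lborel :: real measure"] by simp

definition gauss_density :: "'i set \<Rightarrow> ('i \<Rightarrow> real) \<Rightarrow> real" where
  "gauss_density L x = (\<Prod>k\<in>L. std_normal_density (x k))"

lemma gauss_density_nonneg: "gauss_density L x \<ge> 0"
  by (simp add: gauss_density_def prod_nonneg)

lemma gauss_density_eq_exp: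
  "finite L \<Longrightarrow> gauss_density L x = (1 / sqrt (2 * pi)) ^ card L * exp (- (\<Sum>k\<in>L. (x k)\<^sup>2) / 2)"
  unfolding gauss_density_def std_normal_density_def prod.distrib prod_constant
  by (simp add: exp_sum[symmetric] sum_negf sum_divide_distrib)

lemma PiM_std_gauss_eq_density:
  assumes "finite L"
  shows "PiM L (\<lambda>_. std_gauss) = density (PiM L (\<lambda>_. lborel)) (\<lambda>x. ennreal (gauss_density L x))"
proof -
  interpret G: product_prob_space "\<lambda>_. std_gauss" by (rule product_prob_space_std_gauss)
  interpret product_sigma_finite "\<lambda>_. lborel :: real measure" by (rule product_sigma_finite_lborel)
  note [measurable] = borel_measurable_PiM_lborel_component
  show ?thesis
  proof (rule G.PiM_eqI[symmetric])
    show "sets (density (PiM L (\<lambda>_. lborel)) (\<lambda>x. ennreal (gauss_density L x))) = sets (PiM L (\<lambda>_. std_gauss))"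
      by (simp cong: sets_PiM_cong)
    fix A assume "\<And>i. i \<in> L \<Longrightarrow> A i \<in> sets std_gauss"
    then have A: "\<And>i. i \<in> L \<Longrightarrow> A i \<in> sets borel" by simp
    have boxm: "Pi\<^sub>E L A \<in> sets (PiM L (\<lambda>_. lborel))"
      using A assms by (intro sets_PiM_I_finite) auto
    have densm: "gauss_density L \<in> borel_measurable (PiM L (\<lambda>_. lborel))"
      unfolding gauss_density_def by measurable
    have "emeasure (density (PiM L (\<lambda>_. lborel)) (\<lambda>x. ennreal (gauss_density L x))) (Pi\<^sub>E L A)
      = (\<integral>\<^sup>+ x. ennreal (gauss_density L x) * indicator (Pi\<^sub>E L A) x \<partial>PiM L (\<lambda>_. lborel))"
      by (rule emeasure_density[OF measurable_compose[OF densm measurable_ennreal] boxm])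
    also have "\<dots> = (\<integral>\<^sup>+ x. (\<Prod>k\<in>L. ennreal (std_normal_density (x k)) * indicator (A k) (x k)) \<partial>PiM L (\<lambda>_. lborel))"
    proof (rule nn_integral_cong)
      fix x assume x: "x \<in> space (PiM L (\<lambda>_. lborel :: real measure))"
      have "indicator (Pi\<^sub>E L A) x = (\<Prod>k\<in>L. indicator (A k) (x k) :: ennreal)"
      proof (cases "x \<in> Pi\<^sub>E L A")
        case True
        then have "\<And>k. k \<in> L \<Longrightarrow> indicator (A k) (x k) = (1 :: ennreal)" by (auto simp: PiE_iff)
        then show ?thesis using True by simp
      next
        case False
        then obtain k where "k \<in> L" "x k \<notin> A k" using x by (auto simp: PiE_iff space_PiM)
        then have "(\<Prod>k\<in>L. indicator (A k) (x k) :: ennreal) = 0" using assms by (intro prod_zero bexI[of _ k]) auto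
        then show ?thesis using False by simp
      qed
      then show "ennreal (gauss_density L x) * indicator (Pi\<^sub>E L A) x =
        (\<Prod>k\<in>L. ennreal (std_normal_density (x k)) * indicator (A k) (x k))"
        by (simp add: gauss_density_def prod.distrib prod_ennreal)
    qed
    also have "\<dots> = (\<Prod>k\<in>L. \<integral>\<^sup>+ x. ennreal (std_normal_density x) * indicator (A k) x \<partial>lborel)"
      by (rule product_nn_integral_prod) (use assms A in auto)
    also have "\<dots> = (\<Prod>k\<in>L. emeasure std_gauss (A k))"
      using A by (intro prod.cong) (auto simp: emeasure_density)
    finally show "emeasure (density (PiM L (\<lambda>_. lborel)) (\<lambda>x. ennreal (gauss_density L x))) (Pi\<^sub>E L A)
      = (\<Prod>i\<in>L. emeasure std_gauss (A i))" .
  qed (use assms in auto)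
qed

text \<open>A shear is a translation of one variable for each fixed value of the other, so this
  invariance is what the shears below need.\<close>

lemma nn_integral_PiM_lborel_translate:
  fixes a :: "'i \<Rightarrow> real"
  assumes "finite L" and f: "f \<in> borel_measurable (PiM L (\<lambda>_. lborel))"
  shows "(\<integral>\<^sup>+ x. f (\<lambda>k\<in>L. x k + a k) \<partial>PiM L (\<lambda>_. lborel)) = (\<integral>\<^sup>+ x. f x \<partial>PiM L (\<lambda>_. lborel))"
proof -
  interpret product_sigma_finite "\<lambda>_. lborel :: real measure" by (rule product_sigma_finite_lborel)
  let ?P = "PiM L (\<lambda>_. lborel :: real measure)"
  note [measurable] = borel_measurable_PiM_lborel_component
  have T [measurable]: "(\<lambda>x. \<lambda>k\<in>L. x k + a k) \<in> ?P \<rightarrow>\<^sub>M ?P"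
    by (rule measurable_restrict) simp
  have "distr ?P ?P (\<lambda>x. \<lambda>k\<in>L. x k + a k) = ?P"
  proof (rule PiM_eqI)
    fix A :: "'i \<Rightarrow> real set" assume A: "\<And>i. i \<in> L \<Longrightarrow> A i \<in> sets lborel"
    have pre: "(\<lambda>x. x + a k) -` A k \<in> sets borel" if "k \<in> L" for k
      using measurable_sets[of "\<lambda>x. x + a k" borel borel "A k"] A[OF that] by simp
    have "(\<lambda>x. \<lambda>k\<in>L. x k + a k) -` Pi\<^sub>E L A \<inter> space ?P = (\<Pi>\<^sub>E k\<in>L. (\<lambda>x. x + a k) -` A k)"
      by (auto simp: space_PiM PiE_iff)
    then have "emeasure (distr ?P ?P (\<lambda>x. \<lambda>k\<in>L. x k + a k)) (Pi\<^sub>E L A) = emeasure ?P (\<Pi>\<^sub>E k\<in>L. (\<lambda>x. x + a k) -` A k)"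
      using A assms(1) by (subst emeasure_distr) auto
    also have "\<dots> = (\<Prod>k\<in>L. emeasure lborel ((\<lambda>x. x + a k) -` A k))"
      by (rule emeasure_PiM[OF assms(1)]) (use pre in auto)
    also have "\<dots> = (\<Prod>k\<in>L. emeasure lborel (A k))"
    proof (rule prod.cong)
      fix k assume k: "k \<in> L"
      have "emeasure lborel (A k) = emeasure (distr lborel borel ((+) (a k))) (A k)"
        by (simp add: lborel_distr_plus)
      also have "\<dots> = emeasure lborel ((\<lambda>x. x + a k) -` A k)"
        using A[OF k] by (subst emeasure_distr) (auto intro!: arg_cong[of _ _ "emeasure lborel"] simp: add.commute)
      finally show "emeasure lborel ((\<lambda>x. x + a k) -` A k) = emeasure lborel (A k)" by simp
    qed simp
    finally show "emeasure (distr ?P ?P (\<lambda>x. \<lambda>k\<in>L. x k + a k)) (Pi\<^sub>E L A) = (\<Prod>i\<in>L. emeasure lborel (A i))" .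
  qed (use assms in auto)
  then show ?thesis using nn_integral_distr[OF T, of f] f by simp
qed

text \<open>Replacing the vector of normalised column sums of \<open>g\<close> by an independent copy \<open>h\<close> does not change
  the law of \<open>g\<close>: \<open>(g, h) \<mapsto> (g', h')\<close>, where \<open>h'\<close> are the old normalised column sums, is an orthogonal
  reflection, and it is a composition of shears, which preserve Lebesgue measure.\<close>

definition replace_means :: "nat \<Rightarrow> nat \<Rightarrow> (nat \<times> nat \<Rightarrow> real) \<Rightarrow> (nat \<Rightarrow> real) \<Rightarrow> nat \<times> nat \<Rightarrow> real" where
  "replace_means m n g h = (\<lambda>(i, j)\<in>{..<m} \<times> {..<n}. g (i, j) + (h j - (\<Sum>k<m. g (k, j)) / sqrt m) / sqrt m)"

lemma nn_integral_gauss_matrix_replace_means: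
  assumes m: "0 < m" and f [measurable]: "f \<in> borel_measurable (gauss_matrix m n)"
  shows "(\<integral>\<^sup>+ W. f W \<partial>gauss_matrix m n) =
    (\<integral>\<^sup>+ h. (\<integral>\<^sup>+ g. f (replace_means m n g h) \<partial>gauss_matrix m n) \<partial>PiM {..<n} (\<lambda>_. std_gauss))"
proof -
  define r where "r = sqrt (real m)"
  have r: "r > 0" "r * r = real m" using m by (auto simp: r_def)
  define I where "I = {..<m} \<times> {..<n}"
  define J where "J = {..<n}"
  have fin: "finite I" "finite J" by (auto simp: I_def J_def)
  \<comment> \<open>\<open>\<alpha> g\<close> is the vector of normalised column sums, and
    \<open>T g t\<close> adds \<open>t j / r\<close> to every entry of column \<open>j\<close>; thus
    \<open>replace_means\<close> is \<open>T\<close> at \<open>t = h - \<alpha> g\<close>, as stated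
    in \<open>rm\<close>.\<close>
  define \<alpha> where "\<alpha> g j = (\<Sum>k<m. g (k, j)) / r" for g :: "nat \<times> nat \<Rightarrow> real" and j
  define T where "T g t = (\<lambda>p\<in>I. g p + t (snd p) / r)" for g and t :: "nat \<Rightarrow> real"
  let ?I = "PiM I (\<lambda>_. lborel :: real measure)" and ?J = "PiM J (\<lambda>_. lborel :: real measure)"
  let ?\<phi> = "\<lambda>L x. ennreal (gauss_density L x)"
  interpret product_sigma_finite "\<lambda>_. lborel :: real measure" by (rule product_sigma_finite_lborel)
  interpret I: finite_product_sigma_finite "\<lambda>_. lborel :: real measure" I by standard (rule fin)
  interpret J: finite_product_sigma_finite "\<lambda>_. lborel :: real measure" J by standard (rule fin)
  interpret P: pair_sigma_finite ?I ?J by standard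
  have G: "gauss_matrix m n = density ?I (?\<phi> I)"
    unfolding gauss_matrix_def I_def by (rule PiM_std_gauss_eq_density) simp
  have GJ: "PiM {..<n} (\<lambda>_. std_gauss) = density ?J (?\<phi> J)"
    unfolding J_def by (rule PiM_std_gauss_eq_density) simp
  have f' [measurable]: "f \<in> borel_measurable ?I" using f by (simp add: G)
  have comp [measurable]: "(\<lambda>x. fst x p) \<in> borel_measurable (?I \<Otimes>\<^sub>M ?J)" if "p \<in> I" for p
    using measurable_compose[OF measurable_fst borel_measurable_PiM_lborel_component[OF that]] .
  have comp' [measurable]: "(\<lambda>x. snd x j) \<in> borel_measurable (?I \<Otimes>\<^sub>M ?J)" if "j \<in> J" for j
    using measurable_compose[OF measurable_snd borel_measurable_PiM_lborel_component[OF that]] .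
  have \<alpha> [measurable]: "(\<lambda>x. \<alpha> (fst x) j) \<in> borel_measurable (?I \<Otimes>\<^sub>M ?J)" if "j \<in> J" for j
    unfolding \<alpha>_def using that by (intro borel_measurable_divide borel_measurable_sum comp) (auto simp: I_def J_def)
  have phiI: "(\<lambda>x. gauss_density I (u x)) \<in> borel_measurable M"
    if "\<And>p. p \<in> I \<Longrightarrow> (\<lambda>x. u x p) \<in> borel_measurable M" for u :: "'x \<Rightarrow> _" and M
    unfolding gauss_density_def using that by measurable
  have phiJ: "(\<lambda>x. gauss_density J (u x)) \<in> borel_measurable M"
    if "\<And>p. p \<in> J \<Longrightarrow> (\<lambda>x. u x p) \<in> borel_measurable M" for u :: "'x \<Rightarrow> _" and M
    unfolding gauss_density_def using that by measurable
  have phiI1 [measurable]: "gauss_density I \<in> borel_measurable ?I"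
    by (rule phiI) (rule borel_measurable_PiM_lborel_component)
  have phiJ1 [measurable]: "gauss_density J \<in> borel_measurable ?J"
    by (rule phiJ) (rule borel_measurable_PiM_lborel_component)
  have Tm: "(\<lambda>x. T (fst x) (t x)) \<in> ?I \<Otimes>\<^sub>M ?J \<rightarrow>\<^sub>M ?I"
    if t: "\<And>j. j \<in> J \<Longrightarrow> (\<lambda>x. t x j) \<in> borel_measurable (?I \<Otimes>\<^sub>M ?J)" for t
    unfolding T_def
  proof (rule measurable_restrict)
    fix p assume p: "p \<in> I"
    then have [measurable]: "(\<lambda>x. t x (snd p)) \<in> borel_measurable (?I \<Otimes>\<^sub>M ?J)" by (intro t) (auto simp: I_def J_def)
    show "(\<lambda>x. fst x p + t x (snd p) / r) \<in> ?I \<Otimes>\<^sub>M ?J \<rightarrow>\<^sub>M lborel" using p by simp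
  qed
  have T1 [measurable]: "(\<lambda>x. f (T (fst x) (\<lambda>j. snd x j - \<alpha> (fst x) j))) \<in> borel_measurable (?I \<Otimes>\<^sub>M ?J)"
    by (intro measurable_compose[OF Tm f']) measurable
  have T2 [measurable]: "(\<lambda>x. f (T (fst x) (snd x))) \<in> borel_measurable (?I \<Otimes>\<^sub>M ?J)"
    by (intro measurable_compose[OF Tm f']) measurable
  have A1 [measurable]: "(\<lambda>x. gauss_density I (fst x)) \<in> borel_measurable (?I \<Otimes>\<^sub>M ?J)"
    by (rule phiI) (rule comp)
  have A2 [measurable]: "(\<lambda>x. gauss_density J (snd x)) \<in> borel_measurable (?I \<Otimes>\<^sub>M ?J)"
    by (rule phiJ) (rule comp')
  have A3 [measurable]: "(\<lambda>x. gauss_density J (\<lambda>j. snd x j + \<alpha> (fst x) j)) \<in> borel_measurable (?I \<Otimes>\<^sub>M ?J)"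
    by (rule phiJ) measurable
  have A4 [measurable]: "(\<lambda>x. gauss_density J (\<lambda>j. snd x j - \<alpha> (fst x) j)) \<in> borel_measurable (?I \<Otimes>\<^sub>M ?J)"
    by (rule phiJ) measurable
  have swap: "(\<integral>\<^sup>+ h. (\<integral>\<^sup>+ g. u g h \<partial>?I) \<partial>?J) = (\<integral>\<^sup>+ g. (\<integral>\<^sup>+ h. u g h \<partial>?J) \<partial>?I)"
    if "(\<lambda>x. u (fst x) (snd x)) \<in> borel_measurable (?I \<Otimes>\<^sub>M ?J)" for u
    by (rule P.Fubini') (use that in \<open>simp add: case_prod_beta'\<close>)
  have sect1: "(\<lambda>h. u g h) \<in> borel_measurable ?J"
    if "(\<lambda>x. u (fst x) (snd x)) \<in> borel_measurable (?I \<Otimes>\<^sub>M ?J)" "g \<in> space ?I" for u :: "_ \<Rightarrow> _ \<Rightarrow> ennreal" and g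
    using measurable_compose[OF measurable_Pair1'[OF that(2)] that(1)] by simp
  have sect2: "(\<lambda>g. u g h) \<in> borel_measurable ?I"
    if "(\<lambda>x. u (fst x) (snd x)) \<in> borel_measurable (?I \<Otimes>\<^sub>M ?J)" "h \<in> space ?J" for u :: "_ \<Rightarrow> _ \<Rightarrow> ennreal" and h
    using measurable_compose[OF measurable_Pair2'[OF that(2)] that(1)] by simp
  have phi_cong: "gauss_density J u = gauss_density J v" if "\<And>j. j \<in> J \<Longrightarrow> u j = v j" for u v
    unfolding gauss_density_def using that by (intro prod.cong) auto
  have T_cong: "T g u = T g v" if "\<And>j. j \<in> J \<Longrightarrow> u j = v j" for g u v
    unfolding T_def using that by (intro restrict_ext) (auto simp: I_def J_def)
  have rm: "replace_means m n g h = T g (\<lambda>j. h j - \<alpha> g j)" for g h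
    unfolding replace_means_def T_def \<alpha>_def r_def I_def by (auto simp: fun_eq_iff restrict_def)
  have "(\<integral>\<^sup>+ h. (\<integral>\<^sup>+ g. f (replace_means m n g h) \<partial>gauss_matrix m n) \<partial>PiM {..<n} (\<lambda>_. std_gauss))
    = (\<integral>\<^sup>+ h. ?\<phi> J h * (\<integral>\<^sup>+ g. ?\<phi> I g * f (T g (\<lambda>j. h j - \<alpha> g j)) \<partial>?I) \<partial>?J)"
  proof -
    have "(\<integral>\<^sup>+ g. f (replace_means m n g h) \<partial>gauss_matrix m n) = (\<integral>\<^sup>+ g. ?\<phi> I g * f (T g (\<lambda>j. h j - \<alpha> g j)) \<partial>?I)"
      if "h \<in> space ?J" for h
      unfolding G rm by (rule nn_integral_density) (use sect2[OF T1 that] in measurable)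
    moreover have "space (PiM {..<n} (\<lambda>_. std_gauss)) = space ?J" by (simp add: space_PiM J_def)
    ultimately have "(\<integral>\<^sup>+ h. (\<integral>\<^sup>+ g. f (replace_means m n g h) \<partial>gauss_matrix m n) \<partial>PiM {..<n} (\<lambda>_. std_gauss))
      = (\<integral>\<^sup>+ h. (\<integral>\<^sup>+ g. ?\<phi> I g * f (T g (\<lambda>j. h j - \<alpha> g j)) \<partial>?I) \<partial>PiM {..<n} (\<lambda>_. std_gauss))"
      by (intro nn_integral_cong) simp
    also have "\<dots> = (\<integral>\<^sup>+ h. ?\<phi> J h * (\<integral>\<^sup>+ g. ?\<phi> I g * f (T g (\<lambda>j. h j - \<alpha> g j)) \<partial>?I) \<partial>?J)"
      unfolding GJ
    proof (rule nn_integral_density)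
      have "(\<lambda>x. ?\<phi> I (fst x) * f (T (fst x) (\<lambda>j. snd x j - \<alpha> (fst x) j))) \<in> borel_measurable (?I \<Otimes>\<^sub>M ?J)"
        by measurable
      from measurable_compose[OF measurable_pair_swap' this]
      show "(\<lambda>h. \<integral>\<^sup>+ g. ?\<phi> I g * f (T g (\<lambda>j. h j - \<alpha> g j)) \<partial>?I) \<in> borel_measurable ?J"
        by (intro I.borel_measurable_nn_integral) (simp add: case_prod_beta')
    qed simp
    finally show ?thesis .
  qed
  also have "\<dots> = (\<integral>\<^sup>+ h. (\<integral>\<^sup>+ g. ?\<phi> J h * (?\<phi> I g * f (T g (\<lambda>j. h j - \<alpha> g j))) \<partial>?I) \<partial>?J)"
    by (intro nn_integral_cong nn_integral_cmult[symmetric] borel_measurable_times) (use sect2[OF T1] in measurable)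
  also have "\<dots> = (\<integral>\<^sup>+ g. (\<integral>\<^sup>+ h. ?\<phi> J h * (?\<phi> I g * f (T g (\<lambda>j. h j - \<alpha> g j))) \<partial>?J) \<partial>?I)"
    by (rule swap) measurable
  \<comment> \<open>First shear: with \<open>g\<close> fixed, \<open>h\<close> is replaced by
    \<open>h + \<alpha> g\<close>.\<close>
  also have "\<dots> = (\<integral>\<^sup>+ g. (\<integral>\<^sup>+ h. ?\<phi> J (\<lambda>j. h j + \<alpha> g j) * (?\<phi> I g * f (T g h)) \<partial>?J) \<partial>?I)"
  proof (rule nn_integral_cong)
    fix g assume g: "g \<in> space ?I"
    have "(\<lambda>h. ?\<phi> J h * (?\<phi> I g * f (T g (\<lambda>j. h j - \<alpha> g j)))) \<in> borel_measurable ?J"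
      by (rule sect1[OF _ g]) measurable
    from nn_integral_PiM_lborel_translate[OF fin(2) this, of "\<alpha> g", symmetric]
    have "(\<integral>\<^sup>+ h. ?\<phi> J h * (?\<phi> I g * f (T g (\<lambda>j. h j - \<alpha> g j))) \<partial>?J) =
      (\<integral>\<^sup>+ h. ?\<phi> J (\<lambda>j\<in>J. h j + \<alpha> g j) * (?\<phi> I g * f (T g (\<lambda>j. (\<lambda>j\<in>J. h j + \<alpha> g j) j - \<alpha> g j))) \<partial>?J)" .
    also have "\<dots> = (\<integral>\<^sup>+ h. ?\<phi> J (\<lambda>j. h j + \<alpha> g j) * (?\<phi> I g * f (T g h)) \<partial>?J)"
    proof (rule nn_integral_cong)
      fix h
      have "gauss_density J (\<lambda>j\<in>J. h j + \<alpha> g j) = gauss_density J (\<lambda>j. h j + \<alpha> g j)"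
        by (rule phi_cong) simp
      moreover have "T g (\<lambda>j. (\<lambda>j\<in>J. h j + \<alpha> g j) j - \<alpha> g j) = T g h"
        by (rule T_cong) simp
      ultimately show "?\<phi> J (\<lambda>j\<in>J. h j + \<alpha> g j) * (?\<phi> I g * f (T g (\<lambda>j. (\<lambda>j\<in>J. h j + \<alpha> g j) j - \<alpha> g j)))
        = ?\<phi> J (\<lambda>j. h j + \<alpha> g j) * (?\<phi> I g * f (T g h))"
        by (simp only:)
    qed
    finally show "(\<integral>\<^sup>+ h. ?\<phi> J h * (?\<phi> I g * f (T g (\<lambda>j. h j - \<alpha> g j))) \<partial>?J) =
      (\<integral>\<^sup>+ h. ?\<phi> J (\<lambda>j. h j + \<alpha> g j) * (?\<phi> I g * f (T g h)) \<partial>?J)" .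
  qed
  also have "\<dots> = (\<integral>\<^sup>+ h. (\<integral>\<^sup>+ g. ?\<phi> J (\<lambda>j. h j + \<alpha> g j) * (?\<phi> I g * f (T g h)) \<partial>?I) \<partial>?J)"
    by (rule swap[symmetric]) measurable
  \<comment> \<open>Second shear: with \<open>h\<close> fixed, \<open>h j / r\<close> is subtracted
    from every entry of column \<open>j\<close>. This undoes \<open>T\<close> and turns
    \<open>\<alpha> g\<close> into \<open>\<alpha> g - h\<close>, so the argument
    \<open>h + \<alpha> g\<close> of the density becomes \<open>\<alpha> g\<close>.\<close>
  also have "\<dots> = (\<integral>\<^sup>+ h. (\<integral>\<^sup>+ g. ?\<phi> J (\<lambda>j. h j - \<alpha> g j) * (?\<phi> I g * f g) \<partial>?I) \<partial>?J)"
  proof (rule nn_integral_cong)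
    fix h assume h: "h \<in> space ?J"
    have "(\<lambda>g. ?\<phi> J (\<lambda>j. h j + \<alpha> g j) * (?\<phi> I g * f (T g h))) \<in> borel_measurable ?I"
      by (rule sect2[OF _ h]) measurable
    from nn_integral_PiM_lborel_translate[OF fin(1) this, of "\<lambda>p. - h (snd p) / r", symmetric]
    have "(\<integral>\<^sup>+ g. ?\<phi> J (\<lambda>j. h j + \<alpha> g j) * (?\<phi> I g * f (T g h)) \<partial>?I) =
      (\<integral>\<^sup>+ g. (let g' = (\<lambda>p\<in>I. g p + - h (snd p) / r) in ?\<phi> J (\<lambda>j. h j + \<alpha> g' j) * (?\<phi> I g' * f (T g' h))) \<partial>?I)"
      unfolding Let_def .
    also have "\<dots> = (\<integral>\<^sup>+ g. ?\<phi> J (\<lambda>j. h j - \<alpha> g j) * (?\<phi> I g * f g) \<partial>?I)"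
    proof (rule nn_integral_cong)
      fix g assume g: "g \<in> space ?I"
      define g' where "g' = (\<lambda>p\<in>I. g p + - h (snd p) / r)"
      have Tg: "T g' h = g" using g by (auto simp: T_def g'_def space_PiM fun_eq_iff PiE_iff extensional_def)
      have \<alpha>g: "\<alpha> g' j = \<alpha> g j - h j" if "j \<in> J" for j
      proof -
        have "(\<Sum>k<m. g' (k, j)) = (\<Sum>k<m. g (k, j) - h j / r)"
          using that by (intro sum.cong) (auto simp: g'_def I_def J_def)
        also have "\<dots> = (\<Sum>k<m. g (k, j)) - r * h j"
          using r by (simp add: sum_subtractf flip: r(2))
        finally show ?thesis using r by (simp add: \<alpha>_def field_simps)
      qed
      have "gauss_density J (\<lambda>j. h j + \<alpha> g' j) = gauss_density J (\<alpha> g)"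
        by (rule phi_cong) (simp add: \<alpha>g)
      \<comment> \<open>Invariance of the squared norm: expanding the squares of \<open>g'\<close>
        gives those of \<open>g\<close>, minus twice the inner product of \<open>h\<close> with
        \<open>\<alpha> g\<close>, plus those of \<open>h\<close>. Adding the squares of
        \<open>\<alpha> g\<close> completes the square of \<open>h - \<alpha> g\<close>.\<close>
      moreover have "gauss_density J (\<alpha> g) * gauss_density I g' = gauss_density J (\<lambda>j. h j - \<alpha> g j) * gauss_density I g"
      proof -
        have "(\<Sum>p\<in>I. (g' p)\<^sup>2) = (\<Sum>p\<in>I. (g p)\<^sup>2 - 2 * (g p * (h (snd p) / r)) + (h (snd p) / r)\<^sup>2)"
          by (intro sum.cong) (auto simp: g'_def power2_eq_square algebra_simps)
        also have "\<dots> = (\<Sum>p\<in>I. (g p)\<^sup>2) - 2 * (\<Sum>p\<in>I. g p * (h (snd p) / r)) + (\<Sum>p\<in>I. (h (snd p) / r)\<^sup>2)"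
          by (simp add: sum.distrib sum_subtractf sum_distrib_left)
        also have "(\<Sum>p\<in>I. g p * (h (snd p) / r)) = (\<Sum>j\<in>J. h j * \<alpha> g j)"
        proof -
          have "(\<Sum>p\<in>I. g p * (h (snd p) / r)) = (\<Sum>i<m. \<Sum>j<n. g (i, j) * (h j / r))"
            unfolding I_def sum.cartesian_product by (simp add: case_prod_beta')
          also have "\<dots> = (\<Sum>j\<in>J. h j * \<alpha> g j)"
            unfolding J_def by (subst sum.swap) (simp add: \<alpha>_def sum_distrib_left sum_divide_distrib mult_ac)
          finally show ?thesis .
        qed
        also have "(\<Sum>p\<in>I. (h (snd p) / r)\<^sup>2) = (\<Sum>j\<in>J. (h j)\<^sup>2)"
        proof -
          have "(\<Sum>p\<in>I. (h (snd p) / r)\<^sup>2) = (\<Sum>i<m. \<Sum>j<n. (h j / r)\<^sup>2)"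
            unfolding I_def sum.cartesian_product by (simp add: case_prod_beta')
          also have "\<dots> = real m * (\<Sum>j\<in>J. (h j)\<^sup>2 / (r * r))"
            by (simp add: J_def power_divide power2_eq_square)
          also have "\<dots> = (\<Sum>j\<in>J. (h j)\<^sup>2)"
            using m by (simp add: r(2) flip: sum_divide_distrib)
          finally show ?thesis .
        qed
        finally have "(\<Sum>j\<in>J. (\<alpha> g j)\<^sup>2) + (\<Sum>p\<in>I. (g' p)\<^sup>2) =
           (\<Sum>j\<in>J. (h j - \<alpha> g j)\<^sup>2) + (\<Sum>p\<in>I. (g p)\<^sup>2)"
          by (simp add: power2_diff sum.distrib sum_subtractf sum_distrib_left mult.assoc)
        then have "exp (- (\<Sum>j\<in>J. (\<alpha> g j)\<^sup>2) / 2) * exp (- (\<Sum>p\<in>I. (g' p)\<^sup>2) / 2) =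
           exp (- (\<Sum>j\<in>J. (h j - \<alpha> g j)\<^sup>2) / 2) * exp (- (\<Sum>p\<in>I. (g p)\<^sup>2) / 2)"
          unfolding exp_add[symmetric] by (simp add: field_simps)
        then show ?thesis by (simp add: gauss_density_eq_exp fin)
      qed
      ultimately have "?\<phi> J (\<lambda>j. h j + \<alpha> g' j) * (?\<phi> I g' * f (T g' h)) = ?\<phi> J (\<lambda>j. h j - \<alpha> g j) * (?\<phi> I g * f g)"
        by (simp add: Tg gauss_density_nonneg ennreal_mult[symmetric] flip: mult.assoc)
      then show "(let g' = (\<lambda>p\<in>I. g p + - h (snd p) / r) in ?\<phi> J (\<lambda>j. h j + \<alpha> g' j) * (?\<phi> I g' * f (T g' h)))
        = ?\<phi> J (\<lambda>j. h j - \<alpha> g j) * (?\<phi> I g * f g)"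
        unfolding Let_def g'_def .
    qed
    finally show "(\<integral>\<^sup>+ g. ?\<phi> J (\<lambda>j. h j + \<alpha> g j) * (?\<phi> I g * f (T g h)) \<partial>?I) =
      (\<integral>\<^sup>+ g. ?\<phi> J (\<lambda>j. h j - \<alpha> g j) * (?\<phi> I g * f g) \<partial>?I)" .
  qed
  also have "\<dots> = (\<integral>\<^sup>+ g. (\<integral>\<^sup>+ h. ?\<phi> J (\<lambda>j. h j - \<alpha> g j) * (?\<phi> I g * f g) \<partial>?J) \<partial>?I)"
    by (rule swap) measurable
  \<comment> \<open>Third shear: translating \<open>h\<close> by \<open>\<alpha> g\<close> leaves a
    probability density in \<open>h\<close>, which integrates to 1.\<close>
  also have "\<dots> = (\<integral>\<^sup>+ g. ?\<phi> I g * f g \<partial>?I)"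
  proof (rule nn_integral_cong)
    fix g assume g: "g \<in> space ?I"
    have "(\<lambda>h. ?\<phi> J (\<lambda>j. h j - \<alpha> g j)) \<in> borel_measurable ?J"
      by (rule sect1[OF _ g]) measurable
    then have "(\<integral>\<^sup>+ h. ?\<phi> J (\<lambda>j. h j - \<alpha> g j) * (?\<phi> I g * f g) \<partial>?J) = (\<integral>\<^sup>+ h. ?\<phi> J (\<lambda>j. h j - \<alpha> g j) \<partial>?J) * (?\<phi> I g * f g)"
      by (rule nn_integral_multc)
    also have "(\<integral>\<^sup>+ h. ?\<phi> J (\<lambda>j. h j - \<alpha> g j) \<partial>?J) = (\<integral>\<^sup>+ h. ?\<phi> J (\<lambda>j\<in>J. h j + - \<alpha> g j) \<partial>?J)"
      by (intro nn_integral_cong arg_cong[of _ _ ennreal] phi_cong) simp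
    also have "\<dots> = (\<integral>\<^sup>+ h. ?\<phi> J h \<partial>?J)"
      by (rule nn_integral_PiM_lborel_translate[OF fin(2)]) measurable
    also have "\<dots> = emeasure (density ?J (?\<phi> J)) (space ?J)"
      by (subst emeasure_density) (auto intro!: nn_integral_cong)
    also have "\<dots> = 1"
      using prob_space.emeasure_space_1[OF prob_space_PiM[of J "\<lambda>_. std_gauss", OF prob_space_std_gauss]]
      by (simp add: GJ[folded J_def])
    finally show "(\<integral>\<^sup>+ h. ?\<phi> J (\<lambda>j. h j - \<alpha> g j) * (?\<phi> I g * f g) \<partial>?J) = ?\<phi> I g * f g" by simp
  qed
  also have "\<dots> = (\<integral>\<^sup>+ W. f W \<partial>gauss_matrix m n)"
    unfolding G by (rule nn_integral_density[symmetric]) measurable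
  finally show ?thesis by simp
qed

subsection \<open>Concentration\<close>

text \<open>Chebyshev's inequality for the sum: after centring, independence makes the mixed second
  moments vanish, so only the individual variances remain.\<close>

lemma (in prob_space) prob_indep_sum_deviation_le:
  fixes X :: "'i \<Rightarrow> 'a \<Rightarrow> real"
  assumes fin: "finite I" and ind: "indep_vars (\<lambda>_. borel) X I"
    and sq: "\<And>i. i \<in> I \<Longrightarrow> integrable M (\<lambda>x. (X i x)\<^sup>2)"
    and mean: "\<And>i. i \<in> I \<Longrightarrow> expectation (X i) = \<mu>"
    and var: "\<And>i. i \<in> I \<Longrightarrow> variance (X i) \<le> V" and t: "t > 0"
  shows "prob {x \<in> space M. t \<le> \<bar>(\<Sum>i\<in>I. X i x) - real (card I) * \<mu>\<bar>} \<le> real (card I) * V / t\<^sup>2"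
proof -
  have rv [measurable]: "random_variable borel (X i)" if "i \<in> I" for i
    using ind that by (auto simp: indep_vars_def)
  have int: "integrable M (X i)" if "i \<in> I" for i
    using square_integrable_imp_integrable[OF rv[OF that] sq[OF that]] .
  define Y where "Y i x = X i x - \<mu>" for i x
  have intY: "integrable M (Y i)" if "i \<in> I" for i
    unfolding Y_def using int[OF that] by simp
  have meanY: "expectation (Y i) = 0" if "i \<in> I" for i
    unfolding Y_def using int[OF that] mean[OF that] by (simp add: prob_space)
  have sqY: "integrable M (\<lambda>x. Y i x * Y i x)" if "i \<in> I" for i
  proof -
    have "integrable M (\<lambda>x. (X i x)\<^sup>2 - 2 * \<mu> * X i x + \<mu>\<^sup>2)"
      using int[OF that] sq[OF that] by (intro Bochner_Integration.integrable_add Bochner_Integration.integrable_diff) auto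
    then show ?thesis by (rule back_subst[of "integrable M"]) (auto simp: Y_def fun_eq_iff power2_eq_square algebra_simps)
  qed
  have indY: "indep_vars (\<lambda>_. borel) Y I"
    unfolding Y_def by (rule indep_vars_compose2[OF ind, of "\<lambda>_ x. x - \<mu>"]) simp
  have cross: "integrable M (\<lambda>x. Y i x * Y j x)" "expectation (\<lambda>x. Y i x * Y j x) = 0"
    if ij: "i \<in> I" "j \<in> I" "i \<noteq> j" for i j
  proof -
    have ind2: "indep_vars (\<lambda>_. borel) Y {i, j}" by (rule indep_vars_subset[OF indY]) (use ij in auto)
    have "integrable M (\<lambda>x. \<Prod>k\<in>{i, j}. Y k x)"
      by (rule indep_vars_integrable[OF _ ind2]) (use intY ij in auto)
    then show "integrable M (\<lambda>x. Y i x * Y j x)" using ij by simp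
    have "expectation (\<lambda>x. \<Prod>k\<in>{i, j}. Y k x) = (\<Prod>k\<in>{i, j}. expectation (Y k))"
      by (rule indep_vars_lebesgue_integral[OF _ ind2]) (use intY ij in auto)
    then show "expectation (\<lambda>x. Y i x * Y j x) = 0" using ij meanY by simp
  qed
  have intYY: "integrable M (\<lambda>x. Y i x * Y j x)" if "i \<in> I" "j \<in> I" for i j
    using cross(1)[of i j] sqY that by (cases "i = j") auto
  let ?S = "\<lambda>x. \<Sum>i\<in>I. X i x"
  have ES: "expectation ?S = real (card I) * \<mu>"
    using int mean by (subst Bochner_Integration.integral_sum) auto
  have eq: "(?S x - real (card I) * \<mu>)\<^sup>2 = (\<Sum>i\<in>I. \<Sum>j\<in>I. Y i x * Y j x)" for x
    by (simp add: Y_def sum_subtractf power2_eq_square flip: sum_product)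
  have int_eq: "integrable M (\<lambda>x. (?S x - real (card I) * \<mu>)\<^sup>2)"
    unfolding eq by (intro Bochner_Integration.integrable_sum intYY)
  have intS: "integrable M ?S" using int by (intro Bochner_Integration.integrable_sum)
  have "integrable M (\<lambda>x. (?S x - real (card I) * \<mu>)\<^sup>2 + 2 * (real (card I) * \<mu>) * ?S x - (real (card I) * \<mu>)\<^sup>2)"
    using int_eq intS by (intro Bochner_Integration.integrable_add Bochner_Integration.integrable_diff) auto
  then have sqS: "integrable M (\<lambda>x. (?S x)\<^sup>2)"
    by (rule back_subst[of "integrable M"]) (auto simp: fun_eq_iff power2_eq_square algebra_simps)
  have "variance ?S = expectation (\<lambda>x. \<Sum>i\<in>I. \<Sum>j\<in>I. Y i x * Y j x)"
    by (simp add: ES eq)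
  also have "\<dots> = (\<Sum>i\<in>I. \<Sum>j\<in>I. expectation (\<lambda>x. Y i x * Y j x))"
    using intYY by (simp add: Bochner_Integration.integral_sum Bochner_Integration.integrable_sum)
  also have "\<dots> = (\<Sum>i\<in>I. \<Sum>j\<in>I. if i = j then variance (X i) else 0)"
    using cross(2) mean by (intro sum.cong) (auto simp: Y_def power2_eq_square)
  also have "\<dots> \<le> real (card I) * V"
    using fin var sum_bounded_above[of I "\<lambda>i. variance (X i)" V] by simp
  finally have "variance ?S \<le> real (card I) * V" .
  moreover have "prob {x \<in> space M. t \<le> \<bar>?S x - expectation ?S\<bar>} \<le> variance ?S / t\<^sup>2"
    by (rule Chebyshev_inequality[OF _ sqS t]) measurable
  ultimately show ?thesis unfolding ES using t
    by (smt (verit, best) divide_right_mono zero_le_power2)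
qed

lemma indep_vars_PiM_std_gauss:
  assumes "L \<noteq> {}"
  shows "prob_space.indep_vars (PiM L (\<lambda>_. std_gauss)) (\<lambda>_. borel) (\<lambda>k x. x k) L"
proof -
  let ?P = "PiM L (\<lambda>_. std_gauss)"
  interpret prob_space ?P by (rule prob_space_PiM) (rule prob_space_std_gauss)
  have rv: "(\<lambda>x. x k) \<in> borel_measurable ?P" if "k \<in> L" for k
    using measurable_component_singleton[OF that, of "\<lambda>_. std_gauss"] by simp
  have "distr ?P (PiM L (\<lambda>_. borel)) (\<lambda>x. \<lambda>k\<in>L. x k) = distr ?P ?P (\<lambda>x. x)"
    by (rule distr_cong) (auto simp: space_PiM cong: sets_PiM_cong)
  also have "\<dots> = ?P" by (rule distr_id)
  also have "\<dots> = PiM L (\<lambda>k. distr ?P borel (\<lambda>x. x k))"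
  proof (rule PiM_cong)
    fix k assume "k \<in> L"
    then have "std_gauss = distr ?P std_gauss (\<lambda>x. x k)"
      by (intro distr_PiM_component[symmetric] prob_space_std_gauss)
    also have "\<dots> = distr ?P borel (\<lambda>x. x k)" by (rule distr_cong) auto
    finally show "std_gauss = distr ?P borel (\<lambda>x. x k)" .
  qed simp
  finally show ?thesis using indep_vars_iff_distr_eq_PiM'[OF assms rv] by simp
qed

lemma distributed_PiM_std_gauss:
  assumes "k \<in> L"
  shows "distributed (PiM L (\<lambda>_. std_gauss)) lborel (\<lambda>x. x k) std_normal_density"
proof -
  have "distr (PiM L (\<lambda>_. std_gauss)) lborel (\<lambda>x. x k) = distr (PiM L (\<lambda>_. std_gauss)) std_gauss (\<lambda>x. x k)"
    by (rule distr_cong) auto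
  also have "\<dots> = std_gauss"
    using assms by (intro distr_PiM_component prob_space_std_gauss)
  finally show ?thesis
    using measurable_component_singleton[OF assms, of "\<lambda>_. std_gauss"] by (simp add: distributed_def)
qed

text \<open>The squared coordinates are independent with mean 1 and second moment 3, hence variance
  2; the claim is Chebyshev's inequality at deviation \<open>0.009 * n\<close>.\<close>

lemma prob_gauss_norm_small_le:
  assumes "0 < n"
  shows "measure (PiM {..<n} (\<lambda>_. std_gauss))
    {h \<in> space (PiM {..<n} (\<lambda>_. std_gauss)). (\<Sum>j<n. (h j)\<^sup>2) < 0.991 * real n} \<le> 2 / (0.009\<^sup>2 * real n)"
proof -
  let ?P = "PiM {..<n} (\<lambda>_. std_gauss)"
  interpret prob_space ?P by (rule prob_space_PiM) (rule prob_space_std_gauss)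
  have ind: "indep_vars (\<lambda>_. borel) (\<lambda>j h. (h j)\<^sup>2) {..<n}"
    by (rule indep_vars_compose2[OF indep_vars_PiM_std_gauss, where Y="\<lambda>_ x. x\<^sup>2"]) (use assms in auto)
  have D: "distributed ?P lborel (\<lambda>h. h j) std_normal_density" if "j < n" for j
    using that by (intro distributed_PiM_std_gauss) auto
  have int2: "integrable ?P (\<lambda>h. (h j)\<^sup>2)" and int4: "integrable ?P (\<lambda>h. ((h j)\<^sup>2)\<^sup>2)"
    and E2: "expectation (\<lambda>h. (h j)\<^sup>2) = 1" and E4: "expectation (\<lambda>h. ((h j)\<^sup>2)\<^sup>2) = 3" if "j < n" for j
  proof -
    show "integrable ?P (\<lambda>h. (h j)\<^sup>2)"
      using distributed_integrable[OF D[OF that], of "\<lambda>x. x\<^sup>2"] integrable.intros[OF std_normal_moment_even[of 1]] by simp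
    show "integrable ?P (\<lambda>h. ((h j)\<^sup>2)\<^sup>2)"
      using distributed_integrable[OF D[OF that], of "\<lambda>x. (x\<^sup>2)\<^sup>2"] integrable.intros[OF std_normal_moment_even[of 2]]
      by (simp flip: power_mult)
    show "expectation (\<lambda>h. (h j)\<^sup>2) = 1"
      using distributed_integral[OF D[OF that], of "\<lambda>x. x\<^sup>2"] integral_std_normal_moment_even[of 1] by simp
    show "expectation (\<lambda>h. ((h j)\<^sup>2)\<^sup>2) = 3"
      using distributed_integral[OF D[OF that], of "\<lambda>x. (x\<^sup>2)\<^sup>2"] integral_std_normal_moment_even[of 2]
      by (simp add: fact_numeral flip: power_mult)
  qed
  have var: "variance (\<lambda>h. (h j)\<^sup>2) \<le> 2" if "j < n" for j
    using variance_eq[OF int2[OF that] int4[OF that]] E2[OF that] E4[OF that] by simp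
  have [measurable]: "(\<lambda>h. \<Sum>j<n. (h j)\<^sup>2) \<in> borel_measurable ?P"
    using D by (intro borel_measurable_sum borel_measurable_power) (auto simp: distributed_def)
  have "prob {h \<in> space ?P. (\<Sum>j<n. (h j)\<^sup>2) < 0.991 * real n} \<le>
    prob {h \<in> space ?P. 0.009 * real n \<le> \<bar>(\<Sum>j<n. (h j)\<^sup>2) - real (card {..<n}) * 1\<bar>}"
    by (rule finite_measure_mono) auto
  also have "\<dots> \<le> real (card {..<n}) * 2 / (0.009 * real n)\<^sup>2"
    by (rule prob_indep_sum_deviation_le[OF _ ind]) (use int4 E2 var assms in auto)
  also have "\<dots> = 2 / (0.009\<^sup>2 * real n)" using assms by (simp add: power2_eq_square field_simps)
  finally show ?thesis .
qed

section \<open>A numerical bound on a Gaussian tail\<close>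

text \<open>The Taylor bound shows that the sine of \<open>3.16 / 6\<close> exceeds
  \<open>1 / 2\<close>, which is the sine of \<open>pi / 6\<close>; monotonicity then compares the
  arguments. The estimate serves to bound the constant of the normal density from below.\<close>

lemma pi_less_316: "pi < 3.16"
proof (rule ccontr)
  assume "\<not> pi < 3.16"
  define x :: real where "x = 3.16 / 6"
  have "\<bar>sin x - (\<Sum>m<5. sin_coeff m * x ^ m)\<bar> \<le> inverse (fact 5) * \<bar>x\<bar> ^ 5"
    by (rule Maclaurin_sin_bound)
  moreover have "{..<5} = {0, 1, 2, 3, 4 :: nat}" by auto
  ultimately have "\<bar>sin x - (x - x ^ 3 / 6)\<bar> \<le> x ^ 5 / 120"
    by (simp add: sin_coeff_def fact_numeral x_def)
  then have "sin x \<ge> x - x ^ 3 / 6 - x ^ 5 / 120" by linarith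
  moreover have "x - x ^ 3 / 6 - x ^ 5 / 120 > 1 / 2" by (simp add: x_def power_divide)
  ultimately have "sin x > 1 / 2" by linarith
  moreover have "sin x \<le> sin (pi / 6)"
    using \<open>\<not> pi < 3.16\<close> by (intro sin_monotone_2pi_le) (auto simp: x_def)
  ultimately show False by (simp add: sin_30)
qed

text \<open>By symmetry the tail is half of the mass outside the interval from \<open>-t\<close> to
  \<open>t\<close>. Inside, \<open>exp (- x\<^sup>2 / 2)\<close> is at least
  \<open>1 - x\<^sup>2 / 2\<close>, whose integral is explicit; this gives mass at least 0.408, and
  \<open>(1 - 0.408) / 2 = 0.296\<close>.\<close>

lemma std_gauss_tail_le: "measure std_gauss {..- 0.54} \<le> 0.296"
proof -
  interpret prob_space std_gauss by (rule prob_space_std_gauss)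
  define t :: real where "t = 0.54"
  have "prob {..-t} = measure (distr std_gauss std_gauss (\<lambda>x. (-1) * x)) {..-t}"
    by (subst distr_std_gauss_sign) auto
  also have "\<dots> = prob ((\<lambda>x. (-1) * x) -` {..-t} \<inter> space std_gauss)"
    by (rule measure_distr) auto
  also have "(\<lambda>x. (-1) * x) -` {..-t} \<inter> space std_gauss = {t..}" by auto
  finally have sym: "prob {..-t} = prob {t..}" .
  define c where "c = 1 / sqrt (2 * pi)"
  have "c > 0" by (simp add: c_def)
  have "ennreal (c * (t - t ^ 3 / 6) - c * ((- t) - (- t) ^ 3 / 6))
    = (\<integral>\<^sup>+ x. ennreal (c * (1 - x\<^sup>2 / 2)) * indicator {-t..t} x \<partial>lborel)"
  proof (rule nn_integral_FTC_Icc[symmetric, where F="\<lambda>x. c * (x - x ^ 3 / 6)"])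
    show "((\<lambda>x. c * (x - x ^ 3 / 6)) has_real_derivative c * (1 - x\<^sup>2 / 2)) (at x)" for x
      by (auto intro!: derivative_eq_intros simp: power2_eq_square)
    show "0 \<le> c * (1 - x\<^sup>2 / 2)" if "x \<in> {-t..t}" for x
    proof -
      have "x\<^sup>2 \<le> 1" using that by (intro abs_square_le_1[THEN iffD2]) (auto simp: t_def)
      then show ?thesis using \<open>c > 0\<close> by simp
    qed
  qed (auto simp: t_def)
  also have "\<dots> \<le> (\<integral>\<^sup>+ x. ennreal (std_normal_density x) * indicator {-t..t} x \<partial>lborel)"
  proof (intro nn_integral_mono mult_right_mono ennreal_leI)
    fix x :: real
    have "1 - x\<^sup>2 / 2 \<le> exp (- x\<^sup>2 / 2)" using exp_ge_add_one_self[of "- x\<^sup>2 / 2"] by simp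
    then show "c * (1 - x\<^sup>2 / 2) \<le> std_normal_density x"
      unfolding std_normal_density_def c_def[symmetric] using \<open>c > 0\<close> by simp
  qed simp
  also have "\<dots> = emeasure std_gauss {-t..t}" by (simp add: emeasure_density)
  also have "\<dots> = ennreal (prob {-t..t})" by (rule emeasure_eq_measure)
  finally have "c * (t - t ^ 3 / 6) - c * ((- t) - (- t) ^ 3 / 6) \<le> prob {-t..t}"
    by (simp add: ennreal_le_iff)
  moreover have "c * (t - t ^ 3 / 6) - c * ((- t) - (- t) ^ 3 / 6) = c * 1.027512"
    by (simp add: t_def power_divide)
  moreover have "c * 1.027512 \<ge> 0.408"
  proof -
    have "sqrt (2 * pi) \<le> 2.518"
      by (rule real_le_lsqrt) (use pi_less_316 in \<open>auto simp: power2_eq_square\<close>)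
    then show ?thesis using pi_gt_zero by (simp add: c_def field_simps)
  qed
  ultimately have mid: "prob {-t..t} \<ge> 0.408" by linarith
  \<comment> \<open>Passing to the open interval makes the three pieces of the line disjoint; the
    endpoints have measure zero.\<close>
  have open_mid: "prob {-t<..<t} = prob {-t..t}"
  proof (rule finite_measure_eq_AE)
    have "AE x in std_gauss. x \<noteq> c" for c
      by (rule AE_I[where N="{c}"]) (auto simp: emeasure_std_gauss_singleton)
    from this[of t] this[of "-t"] show "AE x in std_gauss. (x \<in> {-t<..<t}) = (x \<in> {-t..t})"
      by eventually_elim auto
  qed auto
  have "1 = prob (({..-t} \<union> {t..}) \<union> {-t<..<t})"
  proof -
    have "({..-t} \<union> {t..}) \<union> {-t<..<t} = space std_gauss" by auto
    then show ?thesis by (simp only: prob_space)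
  qed
  also have "\<dots> = prob {..-t} + prob {t..} + prob {-t<..<t}"
  proof -
    have "prob ({..-t} \<union> {t..}) = prob {..-t} + prob {t..}"
      by (rule finite_measure_Union) (auto simp: t_def)
    moreover have "prob (({..-t} \<union> {t..}) \<union> {-t<..<t}) = prob ({..-t} \<union> {t..}) + prob {-t<..<t}"
      by (rule finite_measure_Union) auto
    ultimately show ?thesis by simp
  qed
  finally show ?thesis using sym mid open_mid by (simp add: t_def)
qed

section \<open>Inner products of the rows with a fixed vector\<close>

text \<open>Distinct rows are disjoint blocks of independent entries, which gives independence. Each
  normalised inner product is a combination of independent standard normals whose coefficients
  \<open>h j / H\<close> form a unit vector, so it is again standard normal.\<close>

lemma
  fixes h :: "nat \<Rightarrow> real"
  assumes H: "H = sqrt (\<Sum>j<n. (h j)\<^sup>2)" "H > 0"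
  shows indep_vars_gauss_matrix_row:
      "0 < m \<Longrightarrow> prob_space.indep_vars (gauss_matrix m n) (\<lambda>_. borel) (\<lambda>i g. (\<Sum>j<n. g (i, j) * h j) / H) {..<m}"
    and distributed_gauss_matrix_row:
      "i < m \<Longrightarrow> distributed (gauss_matrix m n) lborel (\<lambda>g. (\<Sum>j<n. g (i, j) * h j) / H) std_normal_density"
proof -
  interpret prob_space "gauss_matrix m n" by (rule prob_space_gauss_matrix)
  have n: "n > 0" using H by (cases n) auto
  have base: "indep_vars (\<lambda>_. borel) (\<lambda>p x. x p) ({..<m} \<times> {..<n})" if "0 < m"
    unfolding gauss_matrix_def by (rule indep_vars_PiM_std_gauss) (use that n in auto)
  show "indep_vars (\<lambda>_. borel) (\<lambda>i g. (\<Sum>j<n. g (i, j) * h j) / H) {..<m}" if "0 < m"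
  proof -
    define K where "K i = {i} \<times> {..<n}" for i :: nat
    have "indep_vars (\<lambda>i. PiM (K i) (\<lambda>_. borel)) (\<lambda>i x. restrict (\<lambda>p. x p) (K i)) {..<m}"
      by (rule indep_vars_restrict[OF base[OF that]]) (auto simp: K_def disjoint_family_on_def)
    then have "indep_vars (\<lambda>_. borel) (\<lambda>i x. (\<Sum>j<n. restrict (\<lambda>p. x p) (K i) (i, j) * h j) / H) {..<m}"
    proof (rule indep_vars_compose2[where Y="\<lambda>i y. (\<Sum>j<n. y (i, j) * h j) / H"])
      fix i
      show "(\<lambda>y. (\<Sum>j<n. y (i, j) * h j) / H) \<in> PiM (K i) (\<lambda>_. borel) \<rightarrow>\<^sub>M borel"
        by (intro borel_measurable_divide borel_measurable_sum borel_measurable_times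
            measurable_component_singleton) (auto simp: K_def)
    qed
    then show ?thesis by (simp add: K_def)
  qed
  show "distributed (gauss_matrix m n) lborel (\<lambda>g. (\<Sum>j<n. g (i, j) * h j) / H) std_normal_density" if i: "i < m"
  proof -
    \<comment> \<open>Coordinates with \<open>h j = 0\<close> are discarded, because the theorem on
      sums of independent normals asks for positive standard deviations. The remaining index set is
      nonempty since \<open>H > 0\<close>.\<close>
    define J where "J = {j. j < n \<and> h j \<noteq> 0}"
    define P where "P = {i} \<times> J"
    have finJ: "finite J" by (simp add: J_def)
    have sumJ: "(\<Sum>j\<in>J. u j * h j) = (\<Sum>j<n. u j * h j)" for u
      by (rule sum.mono_neutral_left) (auto simp: J_def)
    have J: "J \<noteq> {}"
    proof
      assume "J = {}"
      then have "(\<Sum>j<n. h j * h j) = 0" using sumJ[of h] by simp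
      then show False using H by (simp add: power2_eq_square)
    qed
    have sumP: "(\<Sum>p\<in>P. u p) = (\<Sum>j\<in>J. u (i, j))" for u :: "_ \<Rightarrow> real"
      unfolding P_def by (rule sum.reindex_bij_witness[of _ "\<lambda>j. (i, j)" snd]) auto
    have "indep_vars (\<lambda>_. borel) (\<lambda>p x. x p) P"
      by (rule indep_vars_subset[OF base]) (use i in \<open>auto simp: P_def J_def\<close>)
    \<comment> \<open>The form \<open>0 + c * x\<close> is the affine shape in which the image of a
      normal variable is stated.\<close>
    then have ind: "indep_vars (\<lambda>_. borel) (\<lambda>p x. 0 + h (snd p) / H * x p) P"
      by (rule indep_vars_compose2[where Y="\<lambda>p y. 0 + h (snd p) / H * y"]) simp
    have D: "distributed (gauss_matrix m n) lborel (\<lambda>x. 0 + h (snd p) / H * x p)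
        (normal_density (0 + h (snd p) / H * 0) (\<bar>h (snd p) / H\<bar> * 1))" if "p \<in> P" for p
    proof (rule normal_density_affine)
      show "distributed (gauss_matrix m n) lborel (\<lambda>x. x p) std_normal_density"
        unfolding gauss_matrix_def
        by (rule distributed_PiM_std_gauss) (use that i in \<open>auto simp: P_def J_def\<close>)
      show "h (snd p) / H \<noteq> 0" using that H by (auto simp: P_def J_def)
    qed simp
    have "distributed (gauss_matrix m n) lborel (\<lambda>x. \<Sum>p\<in>P. 0 + h (snd p) / H * x p)
       (normal_density (\<Sum>p\<in>P. 0 + h (snd p) / H * 0) (sqrt (\<Sum>p\<in>P. (\<bar>h (snd p) / H\<bar> * 1)\<^sup>2)))"
    proof (rule sum_indep_normal[OF _ _ ind _ D])
      show "finite P" "P \<noteq> {}" using finJ J by (auto simp: P_def)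
      show "0 < \<bar>h (snd p) / H\<bar> * 1" if "p \<in> P" for p using that H by (auto simp: P_def J_def)
    qed
    moreover have "(\<Sum>p\<in>P. 0 + h (snd p) / H * x p) = (\<Sum>j<n. x (i, j) * h j) / H" for x
      using sumJ[of "\<lambda>j. x (i, j)"] by (simp add: sumP sum_divide_distrib[symmetric] mult.commute)
    moreover have "(\<Sum>p\<in>P. (\<bar>h (snd p) / H\<bar> * 1)\<^sup>2) = 1"
    proof -
      have "(\<Sum>p\<in>P. (\<bar>h (snd p) / H\<bar> * 1)\<^sup>2) = (\<Sum>j\<in>J. h j * h j) / H\<^sup>2"
        by (simp add: sumP power_divide power2_eq_square sum_divide_distrib)
      also have "(\<Sum>j\<in>J. h j * h j) = H\<^sup>2"
        using H by (simp add: sumJ power2_eq_square sum_nonneg)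
      finally show ?thesis using H by simp
    qed
    ultimately show ?thesis by simp
  qed
qed

subsection \<open>Few rows\<close>

text \<open>If fewer than \<open>n\<close> rows have nonnegative inner product with
  \<open>x\<close>, some nonzero \<open>d\<close> is orthogonal to all of them, and \<open>d\<close>
  together with \<open>x\<close> in the role of \<open>z\<close> is a witness against
  injectivity.\<close>

lemma inj_relu_layer_imp_card_ge:
  assumes "inj_on (relu_layer m n W) (vecs n)" "x \<in> vecs n"
  shows "n \<le> card {i. i < m \<and> \<not> (\<Sum>j<n. W (i, j) * x j) < 0}"
proof (rule ccontr)
  define A where "A = {i. i < m \<and> \<not> (\<Sum>j<n. W (i, j) * x j) < 0}"
  assume "\<not> n \<le> card {i. i < m \<and> \<not> (\<Sum>j<n. W (i, j) * x j) < 0}"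
  then have "card A < card {..<n}" by (simp add: A_def)
  then have "\<exists>d. (\<forall>j. j \<notin> {..<n} \<longrightarrow> d j = 0) \<and> (\<exists>j\<in>{..<n}. d j \<noteq> 0) \<and> (\<forall>i\<in>A. (\<Sum>j<n. W (i, j) * d j) = 0)"
    by (intro underdetermined_system_nontrivial_solution) (auto simp: A_def)
  then obtain d where d: "\<forall>j. j \<notin> {..<n} \<longrightarrow> d j = 0" "\<exists>j\<in>{..<n}. d j \<noteq> 0" "\<forall>i\<in>A. (\<Sum>j<n. W (i, j) * d j) = 0"
    by (elim exE conjE)
  have "d \<in> vecs n" using d(1) by (simp add: vecs_def)
  moreover have "\<exists>j<n. d j \<noteq> 0" using d(2) by auto
  moreover have "\<forall>i\<in>{..<m} - A. (\<Sum>j<n. W (i, j) * x j) < 0" by (auto simp: A_def)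
  moreover have "A \<subseteq> {..<m}" by (auto simp: A_def)
  ultimately have "\<not> inj_on (relu_layer m n W) (vecs n)"
    unfolding inj_relu_layer_iff using d(3) assms(2) by blast
  then show False using assms(1) by simp
qed

text \<open>The test vector is minus the sum of the rows. After the column sums have been replaced, its inner
  product with row \<open>i\<close> is governed by \<open>\<xi> i = \<langle>g\<^sub>i, h\<rangle> / \<parallel>h\<parallel>\<close>, and the \<open>\<xi> i\<close> are independent standard normal.\<close>

lemma replace_means_row_sum:
  fixes h :: "nat \<Rightarrow> real" and g :: "nat \<times> nat \<Rightarrow> real"
  assumes m: "0 < m" and i: "i < m" and H: "H = sqrt (\<Sum>j<n. (h j)\<^sup>2)" "H > 0"
  defines "\<xi> \<equiv> \<lambda>i. (\<Sum>j<n. g (i, j) * h j) / H"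
  shows "(\<Sum>j<n. replace_means m n g h (i, j) * (\<Sum>k<m. replace_means m n g h (k, j)))
    = sqrt m * H * (\<xi> i + H / sqrt m - (\<Sum>k<m. \<xi> k) / real m)"
proof -
  define r where "r = sqrt (real m)"
  have r: "r > 0" "r * r = real m" using m by (auto simp: r_def)
  have rm: "replace_means m n g h (k, j) = g (k, j) + (h j - (\<Sum>k<m. g (k, j)) / r) / r" if "k < m" "j < n" for k j
    using that by (simp add: replace_means_def r_def)
  \<comment> \<open>The new column sums are \<open>r * h j\<close> by construction, so the sum of
    the rows is a multiple of \<open>h\<close>.\<close>
  have col: "(\<Sum>k<m. replace_means m n g h (k, j)) = r * h j" if "j < n" for j
  proof -
    have "(\<Sum>k<m. replace_means m n g h (k, j)) = (\<Sum>k<m. g (k, j)) + (r * r) * ((h j - (\<Sum>k<m. g (k, j)) / r) / r)"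
      using that by (simp add: rm sum.distrib r(2))
    also have "\<dots> = r * h j" using r(1) by (simp add: field_simps)
    finally show ?thesis .
  qed
  have "(\<Sum>j<n. replace_means m n g h (i, j) * (\<Sum>k<m. replace_means m n g h (k, j)))
    = (\<Sum>j<n. (g (i, j) + (h j - (\<Sum>k<m. g (k, j)) / r) / r) * (r * h j))"
    by (intro sum.cong refl) (subst col, simp, simp add: rm i)
  also have "\<dots> = (\<Sum>j<n. r * (g (i, j) * h j) + (h j)\<^sup>2 - (\<Sum>k<m. g (k, j) * h j) / r)"
    using r(1) by (intro sum.cong) (auto simp: field_simps power2_eq_square sum_distrib_left sum_distrib_right)
  also have "\<dots> = r * (\<Sum>j<n. g (i, j) * h j) + (\<Sum>j<n. (h j)\<^sup>2) - (\<Sum>k<m. \<Sum>j<n. g (k, j) * h j) / r"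
    by (simp add: sum.distrib sum_subtractf sum_distrib_left sum_divide_distrib sum.swap[of _ "{..<m}"])
  also have "(\<Sum>j<n. (h j)\<^sup>2) = H * H" using H by (simp add: sum_nonneg)
  also have "(\<Sum>j<n. g (i, j) * h j) = H * \<xi> i" using H by (simp add: \<xi>_def)
  also have "(\<Sum>k<m. \<Sum>j<n. g (k, j) * h j) = H * (\<Sum>k<m. \<xi> k)"
    using H by (simp add: \<xi>_def flip: sum_divide_distrib)
  also have "r * (H * \<xi> i) + H * H - H * (\<Sum>k<m. \<xi> k) / r = r * H * (\<xi> i + H / r - (\<Sum>k<m. \<xi> k) / (r * r))"
    using r(1) by (simp add: field_simps)
  finally show ?thesis by (simp add: r_def)
qed

text \<open>Nonpositive inner product with the sum of the rows means nonnegative inner product with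
  the test vector, its negative. Injectivity implies this event, which is a plain count of sign
  conditions.\<close>

definition many_nonneg :: "nat \<Rightarrow> nat \<Rightarrow> (nat \<times> nat \<Rightarrow> real) set" where
  "many_nonneg m n = {W \<in> space (gauss_matrix m n).
     n \<le> card {i. i < m \<and> (\<Sum>j<n. W (i, j) * (\<Sum>k<m. W (k, j))) \<le> 0}}"

lemma sets_many_nonneg: "many_nonneg m n \<in> sets (gauss_matrix m n)"
proof -
  have "(\<lambda>W. W p) \<in> borel_measurable (gauss_matrix m n)" if "p \<in> {..<m} \<times> {..<n}" for p
    unfolding gauss_matrix_def using measurable_component_singleton[OF that, of "\<lambda>_. std_gauss"] by simp
  then have [measurable]: "(\<lambda>W. \<Sum>j<n. W (i, j) * (\<Sum>k<m. W (k, j))) \<in> borel_measurable (gauss_matrix m n)"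
    if "i < m" for i using that by (intro borel_measurable_sum borel_measurable_times) auto
  have "{W \<in> space (gauss_matrix m n). real n \<le> (\<Sum>i<m. if (\<Sum>j<n. W (i, j) * (\<Sum>k<m. W (k, j))) \<le> 0 then 1 else 0)}
    \<in> sets (gauss_matrix m n)"
    by measurable
  moreover have "(\<Sum>i<m. if (\<Sum>j<n. W (i, j) * (\<Sum>k<m. W (k, j))) \<le> 0 then 1 else 0) =
    real (card {i. i < m \<and> (\<Sum>j<n. W (i, j) * (\<Sum>k<m. W (k, j))) \<le> 0})" for W
    by (simp add: sum.If_cases Int_def)
  ultimately show ?thesis by (simp add: many_nonneg_def)
qed

lemma inj_imp_many_nonneg:
  assumes "W \<in> space (gauss_matrix m n)" "inj_on (relu_layer m n W) (vecs n)"
  shows "W \<in> many_nonneg m n"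
proof -
  define x where "x j = (if j < n then - (\<Sum>k<m. W (k, j)) else 0)" for j
  have "x \<in> vecs n" by (simp add: x_def vecs_def)
  from inj_relu_layer_imp_card_ge[OF assms(2) this]
  have "n \<le> card {i. i < m \<and> \<not> (\<Sum>j<n. W (i, j) * x j) < 0}" .
  moreover have "(\<Sum>j<n. W (i, j) * x j) = - (\<Sum>j<n. W (i, j) * (\<Sum>k<m. W (k, j)))" for i
    unfolding sum_negf[symmetric] by (intro sum.cong) (auto simp: x_def)
  ultimately show ?thesis using assms(1) by (simp add: many_nonneg_def not_less)
qed

text \<open>Since \<open>m \<le> 10 n / 3\<close>, the lower bound on \<open>\<parallel>h\<parallel>\<close> gives \<open>\<parallel>h\<parallel> / sqrt m \<ge> sqrt (0.3 * 0.991) \<ge> 0.545\<close>. If the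
  mean of the \<open>\<xi> i\<close> is below \<open>0.005\<close>, a counted row therefore has \<open>\<xi> i \<le> - 0.54\<close>, an event of
  probability at most \<open>0.296 < 0.3 \<le> n / m\<close>.\<close>

lemma emeasure_replace_means_many_nonneg_le:
  assumes n: "0 < n" "m = 10 * n div 3" and h: "0.991 * real n \<le> (\<Sum>j<n. (h j)\<^sup>2)"
  shows "emeasure (gauss_matrix m n) {g \<in> space (gauss_matrix m n). replace_means m n g h \<in> many_nonneg m n}
    \<le> ennreal ((1 / 0.005\<^sup>2 + 1 / 0.004\<^sup>2) / real m)"
proof -
  have m: "0 < m" "real m \<le> 10 / 3 * real n" using n by auto
  interpret prob_space "gauss_matrix m n" by (rule prob_space_gauss_matrix)
  define H where "H = sqrt (\<Sum>j<n. (h j)\<^sup>2)"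
  have "0 < 0.991 * real n" using n by simp
  then have "(\<Sum>j<n. (h j)\<^sup>2) > 0" using h by linarith
  then have H: "H > 0" by (simp add: H_def)
  have H_ge: "H / sqrt m \<ge> 0.545"
  proof -
    \<comment> \<open>Here \<open>0.545\<^sup>2 * 10 / 3\<close> is about 0.9901, just below
      0.991.\<close>
    have "(0.545 * sqrt m)\<^sup>2 \<le> 0.991 * real n" using m by (simp add: power_mult_distrib power2_eq_square)
    also have "\<dots> \<le> H\<^sup>2" using h by (simp add: H_def sum_nonneg)
    finally have "0.545 * sqrt m \<le> H" by (rule power2_le_imp_le) (use H in simp)
    then show ?thesis using m by (simp add: le_divide_eq)
  qed
  define \<xi> where "\<xi> i g = (\<Sum>j<n. g (i, j) * h j) / H" for i and g :: "nat \<times> nat \<Rightarrow> real"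
  define \<kappa> where "\<kappa> i g = (indicator {..- 0.54} (\<xi> i g) :: real)" for i g
  define q where "q = measure std_gauss {..- 0.54}"
  have ind: "indep_vars (\<lambda>_. borel) \<xi> {..<m}"
    unfolding \<xi>_def by (rule indep_vars_gauss_matrix_row[OF H_def H m(1)])
  have dist: "distributed (gauss_matrix m n) lborel (\<xi> i) std_normal_density" if "i < m" for i
    unfolding \<xi>_def by (rule distributed_gauss_matrix_row[OF H_def H that])
  have rv [measurable]: "\<xi> i \<in> borel_measurable (gauss_matrix m n)" if "i < m" for i
    using dist[OF that] by (simp add: distributed_def)
  have rv\<kappa> [measurable]: "\<kappa> i \<in> borel_measurable (gauss_matrix m n)" if "i < m" for i
    unfolding \<kappa>_def using rv[OF that] by measurable
  have ind\<kappa>: "indep_vars (\<lambda>_. borel) \<kappa> {..<m}"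
    unfolding \<kappa>_def by (rule indep_vars_compose2[OF ind, where Y="\<lambda>_. indicator {..- 0.54}"]) simp
  have \<kappa>_sq: "(\<lambda>g. (\<kappa> i g)\<^sup>2) = \<kappa> i" for i by (auto simp: \<kappa>_def indicator_def)
  have \<kappa>_le: "\<bar>\<kappa> i g\<bar> \<le> 1" for i g by (simp add: \<kappa>_def indicator_def)
  have int\<kappa>: "integrable (gauss_matrix m n) (\<lambda>g. (\<kappa> i g)\<^sup>2)" "integrable (gauss_matrix m n) (\<kappa> i)" if "i < m" for i
    unfolding \<kappa>_sq by (intro integrable_const_bound[where B=1] rv\<kappa> that; simp add: \<kappa>_le)+
  have E\<kappa>: "expectation (\<kappa> i) = q" if "i < m" for i
  proof -
    have "expectation (\<kappa> i) = (\<integral>x. std_normal_density x * indicator {..- 0.54} x \<partial>lborel)"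
      unfolding \<kappa>_def by (rule distributed_integral[OF dist[OF that], symmetric]) auto
    also have "\<dots> = (\<integral>x. indicator {..- 0.54} x \<partial>std_gauss)"
      by (subst integral_density) auto
    also have "\<dots> = q" by (simp add: q_def)
    finally show ?thesis .
  qed
  have V\<kappa>: "variance (\<kappa> i) \<le> 1" if "i < m" for i
  proof -
    have "variance (\<kappa> i) = expectation (\<lambda>g. (\<kappa> i g)\<^sup>2) - (expectation (\<kappa> i))\<^sup>2"
      by (rule variance_eq) (use int\<kappa>[OF that] in auto)
    also have "expectation (\<lambda>g. (\<kappa> i g)\<^sup>2) - (expectation (\<kappa> i))\<^sup>2 \<le> 1"
      using prob_space.prob_le_1[OF prob_space_std_gauss, of "{..- 0.54}"]
        zero_le_power2[of q] by (simp only: \<kappa>_sq E\<kappa>[OF that] flip: q_def)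
    finally show ?thesis .
  qed
  \<comment> \<open>The two bad events. Deviation 0.005 of the mean of the \<open>\<xi> i\<close> is
    the gap between 0.545 and 0.54; deviation 0.004 of the frequency of
    \<open>\<kappa> i = 1\<close> is the gap between the tail bound 0.296 and 0.3. Each variance is
    at most 1.\<close>
  let ?B1 = "{g \<in> space (gauss_matrix m n). 0.005 * real m \<le> \<bar>(\<Sum>i<m. \<xi> i g) - real (card {..<m}) * 0\<bar>}"
  let ?B2 = "{g \<in> space (gauss_matrix m n). 0.004 * real m \<le> \<bar>(\<Sum>i<m. \<kappa> i g) - real (card {..<m}) * q\<bar>}"
  have [measurable]: "(\<lambda>g. \<Sum>i<m. \<xi> i g) \<in> borel_measurable (gauss_matrix m n)"
    "(\<lambda>g. \<Sum>i<m. \<kappa> i g) \<in> borel_measurable (gauss_matrix m n)"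
    by (intro borel_measurable_sum; simp)+
  have B1: "prob ?B1 \<le> real (card {..<m}) * 1 / (0.005 * real m)\<^sup>2"
  proof (rule prob_indep_sum_deviation_le[OF _ ind])
    fix i assume "i \<in> {..<m}"
    then have i: "i < m" by simp
    show "integrable (gauss_matrix m n) (\<lambda>g. (\<xi> i g)\<^sup>2)"
      using distributed_integrable[OF dist[OF i], of "\<lambda>x. x\<^sup>2"] integrable.intros[OF std_normal_moment_even[of 1]] by simp
    show "expectation (\<xi> i) = 0" "variance (\<xi> i) \<le> 1"
      using standard_normal_distributed_expectation[OF dist[OF i]] standard_normal_distributed_variance[OF dist[OF i]]
      by simp_all
  qed (use m in auto)
  have B2: "prob ?B2 \<le> real (card {..<m}) * 1 / (0.004 * real m)\<^sup>2"
    by (rule prob_indep_sum_deviation_le[OF _ ind\<kappa>]) (use m int\<kappa> E\<kappa> V\<kappa> in auto)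
  have "{g \<in> space (gauss_matrix m n). replace_means m n g h \<in> many_nonneg m n} \<subseteq> ?B1 \<union> ?B2"
  proof (rule subsetI, rule ccontr)
    fix g assume g: "g \<in> {g \<in> space (gauss_matrix m n). replace_means m n g h \<in> many_nonneg m n}" "g \<notin> ?B1 \<union> ?B2"
    then have g1: "\<bar>\<Sum>i<m. \<xi> i g\<bar> < 0.005 * real m" and g2: "\<bar>(\<Sum>i<m. \<kappa> i g) - real m * q\<bar> < 0.004 * real m"
      by auto
    let ?A = "{i. i < m \<and> (\<Sum>j<n. replace_means m n g h (i, j) * (\<Sum>k<m. replace_means m n g h (k, j))) \<le> 0}"
    have "\<kappa> i g = 1" if i: "i \<in> ?A" for i
    proof -
      have "i < m" using i by simp
      have "sqrt m * H * (\<xi> i g + H / sqrt m - (\<Sum>k<m. \<xi> k g) / real m) \<le> 0"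
        using i replace_means_row_sum[OF m(1) \<open>i < m\<close> H_def H, of g] by (simp add: \<xi>_def)
      moreover have "sqrt m * H > 0" using m H by simp
      ultimately have "\<xi> i g + H / sqrt m - (\<Sum>k<m. \<xi> k g) / real m \<le> 0"
        by (meson mult_pos_pos not_le)
      moreover have "(\<Sum>k<m. \<xi> k g) / real m < 0.005"
        using g1 m by (simp add: divide_less_eq)
      moreover have "x \<le> - 0.54" if "x + a - b \<le> 0" "b < 0.005" "0.545 \<le> a" for x a b :: real
        using that by simp
      ultimately have "\<xi> i g \<le> - 0.54" using H_ge by blast
      then show ?thesis by (simp add: \<kappa>_def)
    qed
    then have "real (card ?A) = (\<Sum>i\<in>?A. \<kappa> i g)" by simp
    also have "\<dots> \<le> (\<Sum>i<m. \<kappa> i g)" by (rule sum_mono2) (auto simp: \<kappa>_def)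
    also have "\<dots> < 0.3 * real m"
    proof -
      have "real m * q \<le> real m * 0.296" unfolding q_def by (intro mult_left_mono std_gauss_tail_le) simp
      moreover have "s < 0.3 * k" if "y \<le> k * 0.296" "\<bar>s - y\<bar> < 0.004 * k" for s y k :: real
        using that abs_ge_self[of "s - y"] by simp
      ultimately show ?thesis using g2 by blast
    qed
    also have "\<dots> \<le> real n" using m by simp
    finally show False using g(1) by (auto simp: many_nonneg_def)
  qed
  then have "emeasure (gauss_matrix m n) {g \<in> space (gauss_matrix m n). replace_means m n g h \<in> many_nonneg m n}
    \<le> emeasure (gauss_matrix m n) (?B1 \<union> ?B2)"
    by (rule emeasure_mono) measurable
  also have "\<dots> = ennreal (prob (?B1 \<union> ?B2))" by (rule emeasure_eq_measure)
  also have "\<dots> \<le> ennreal (prob ?B1 + prob ?B2)"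
    by (intro ennreal_leI measure_Un_le) measurable
  also have "\<dots> \<le> ennreal ((1 / 0.005\<^sup>2 + 1 / 0.004\<^sup>2) / real m)"
    using B1 B2 m by (intro ennreal_leI) (simp add: power2_eq_square field_simps)
  finally show ?thesis .
qed

text \<open>Injectivity is relaxed to \<open>many_nonneg\<close>, and the column sums are replaced
  by an independent \<open>h\<close>. If \<open>h\<close> is short, the inner integral is bounded by
  1 and Chebyshev's inequality for the norm applies; otherwise the conditional estimate applies.
  Both contributions are of order \<open>1 / n\<close>.\<close>

lemma inj_prob_le:
  assumes n: "0 < n" and m: "m = 10 * n div 3"
  shows "inj_prob m n \<le> (2 / 0.009\<^sup>2 + (1 / 0.005\<^sup>2 + 1 / 0.004\<^sup>2)) / real n"
proof -
  let ?J = "PiM {..<n} (\<lambda>_. std_gauss)" and ?K = "1 / 0.005\<^sup>2 + 1 / 0.004\<^sup>2 :: real"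
  interpret G: prob_space "gauss_matrix m n" by (rule prob_space_gauss_matrix)
  interpret J: prob_space ?J by (rule prob_space_PiM) (rule prob_space_std_gauss)
  have mn: "n \<le> m" "0 < m" using n m by auto
  note sets_many_nonneg [measurable]
  let ?S = "{h \<in> space ?J. (\<Sum>j<n. (h j)\<^sup>2) < 0.991 * real n}"
  have "(\<lambda>h. h j) \<in> borel_measurable ?J" if "j < n" for j
    using measurable_component_singleton[of j "{..<n}" "\<lambda>_. std_gauss"] that by simp
  then have [measurable]: "(\<lambda>h. \<Sum>j<n. (h j)\<^sup>2) \<in> borel_measurable ?J"
    by (intro borel_measurable_sum borel_measurable_power) auto
  have S [measurable]: "?S \<in> sets ?J" by measurable
  have "ennreal (inj_prob m n) \<le> emeasure (gauss_matrix m n) (many_nonneg m n)"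
    unfolding inj_prob_def G.emeasure_eq_measure[symmetric]
    by (rule emeasure_mono) (use inj_imp_many_nonneg in \<open>auto intro: sets_many_nonneg\<close>)
  also have "\<dots> = (\<integral>\<^sup>+ W. indicator (many_nonneg m n) W \<partial>gauss_matrix m n)" by simp
  also have "\<dots> = (\<integral>\<^sup>+ h. (\<integral>\<^sup>+ g. indicator (many_nonneg m n) (replace_means m n g h) \<partial>gauss_matrix m n) \<partial>?J)"
    by (rule nn_integral_gauss_matrix_replace_means[OF mn(2)]) measurable
  also have "\<dots> \<le> (\<integral>\<^sup>+ h. indicator ?S h + ennreal (?K / real m) \<partial>?J)"
  proof (rule nn_integral_mono)
    fix h assume h: "h \<in> space ?J"
    show "(\<integral>\<^sup>+ g. indicator (many_nonneg m n) (replace_means m n g h) \<partial>gauss_matrix m n) \<le> indicator ?S h + ennreal (?K / real m)"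
    proof (cases "h \<in> ?S")
      case True
      have "(\<integral>\<^sup>+ g. indicator (many_nonneg m n) (replace_means m n g h) \<partial>gauss_matrix m n) \<le> (\<integral>\<^sup>+ g. 1 \<partial>gauss_matrix m n)"
        by (intro nn_integral_mono) (simp add: indicator_def)
      also have "\<dots> = 1" by (simp add: G.emeasure_space_1)
      also have "1 \<le> indicator ?S h + ennreal (?K / real m)" using True by simp
      finally show ?thesis .
    next
      case False
      let ?E = "{g \<in> space (gauss_matrix m n). replace_means m n g h \<in> many_nonneg m n}"
      have rm: "(\<lambda>g. replace_means m n g h) \<in> gauss_matrix m n \<rightarrow>\<^sub>M gauss_matrix m n"
        unfolding gauss_matrix_def replace_means_def
      proof (rule measurable_restrict)
        fix p assume p: "p \<in> {..<m} \<times> {..<n}"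
        have c: "(\<lambda>g. g p) \<in> borel_measurable (PiM ({..<m} \<times> {..<n}) (\<lambda>_. std_gauss))" if "p \<in> {..<m} \<times> {..<n}" for p
          using measurable_component_singleton[OF that, of "\<lambda>_. std_gauss"] by simp
        have "(\<lambda>g. g p + (h (snd p) - (\<Sum>k<m. g (k, snd p)) / sqrt m) / sqrt m)
          \<in> borel_measurable (PiM ({..<m} \<times> {..<n}) (\<lambda>_. std_gauss))"
          using p by (intro borel_measurable_add borel_measurable_divide borel_measurable_diff borel_measurable_sum c) auto
        then show "(\<lambda>g. case p of (i, j) \<Rightarrow> g (i, j) + (h j - (\<Sum>k<m. g (k, j)) / sqrt m) / sqrt m)
          \<in> PiM ({..<m} \<times> {..<n}) (\<lambda>_. std_gauss) \<rightarrow>\<^sub>M std_gauss"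
          by (simp add: case_prod_beta')
      qed
      have E: "?E \<in> sets (gauss_matrix m n)"
        using measurable_sets[OF rm sets_many_nonneg] by (simp add: vimage_def Int_def conj_commute)
      have "(\<integral>\<^sup>+ g. indicator (many_nonneg m n) (replace_means m n g h) \<partial>gauss_matrix m n) = (\<integral>\<^sup>+ g. indicator ?E g \<partial>gauss_matrix m n)"
        by (intro nn_integral_cong) (auto simp: indicator_def)
      also have "\<dots> = emeasure (gauss_matrix m n) ?E" using E by simp
      also have "\<dots> \<le> ennreal (?K / real m)"
        by (rule emeasure_replace_means_many_nonneg_le[OF n m]) (use False h in auto)
      finally show ?thesis using False by simp
    qed
  qed
  also have "\<dots> = emeasure ?J ?S + ennreal (?K / real m)"
    by (subst nn_integral_add) (auto simp: J.emeasure_space_1)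
  also have "\<dots> = ennreal (J.prob ?S + ?K / real m)"
    by (simp add: J.emeasure_eq_measure)
  also have "\<dots> \<le> ennreal ((2 / 0.009\<^sup>2 + ?K) / real n)"
  proof (rule ennreal_leI)
    have "?K / real m \<le> ?K / real n" using mn n by (intro divide_left_mono) auto
    moreover have "J.prob ?S \<le> 2 / 0.009\<^sup>2 / real n" using prob_gauss_norm_small_le[OF n] by simp
    ultimately show "J.prob ?S + ?K / real m \<le> (2 / 0.009\<^sup>2 + ?K) / real n"
      by (simp only: add_divide_distrib)
  qed
  finally show ?thesis by (simp add: ennreal_le_iff)
qed

lemma inj_prob_tendsto_0:
  assumes "\<forall>\<^sub>F n in sequentially. m n \<le> 10 * n div 3"
  shows "(\<lambda>n. inj_prob (m n) n) \<longlonglongrightarrow> 0"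
proof (rule tendsto_sandwich[OF _ _ tendsto_const])
  define C :: real where "C = 2 / 0.009\<^sup>2 + (1 / 0.005\<^sup>2 + 1 / 0.004\<^sup>2)"
  show "\<forall>\<^sub>F n in sequentially. 0 \<le> inj_prob (m n) n"
    by (simp add: inj_prob_def)
  show "\<forall>\<^sub>F n in sequentially. inj_prob (m n) n \<le> C / real n"
    using assms eventually_gt_at_top[of 0]
  proof eventually_elim
    case (elim n)
    have "inj_prob (m n) n \<le> inj_prob (10 * n div 3) n" by (rule inj_prob_mono) (rule elim)
    also have "\<dots> \<le> C / real n" unfolding C_def by (rule inj_prob_le) (use elim in auto)
    finally show ?case .
  qed
  show "(\<lambda>n. C / real n) \<longlonglongrightarrow> 0" by (rule lim_const_over_n)
qed

section \<open>The two regimes of the aspect ratio\<close>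

theorem theorem2:
  fixes c :: real and m :: "nat \<Rightarrow> nat"
  assumes "(\<lambda>n. real (m n) / real n) \<longlonglongrightarrow> c"
  shows "(c \<ge> 10.5 \<longrightarrow> (\<lambda>n. inj_prob (m n) n) \<longlonglongrightarrow> 1)
       \<and> (c \<le> 3.3 \<longrightarrow> (\<lambda>n. inj_prob (m n) n) \<longlonglongrightarrow> 0)"
proof (intro conjI impI)
  assume "c \<ge> 10.5"
  \<comment> \<open>The ratio only converges to \<open>c\<close>, so the threshold 10.4 is placed
    strictly below 10.5 to hold eventually even when \<open>c = 10.5\<close>.\<close>
  then have "\<forall>\<^sub>F n in sequentially. 10.4 < real (m n) / real n"
    by (intro order_tendstoD(1)[OF assms]) simp
  then have "\<forall>\<^sub>F n in sequentially. 10.4 * real n \<le> real (m n)"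
    using eventually_gt_at_top[of 0] by eventually_elim (simp add: field_simps)
  then show "(\<lambda>n. inj_prob (m n) n) \<longlonglongrightarrow> 1"
    by (rule inj_prob_tendsto_1)
next
  assume "c \<le> 3.3"
  \<comment> \<open>Likewise \<open>10 / 3\<close> lies strictly above 3.3, which covers
    \<open>c = 3.3\<close>; the integer \<open>m n\<close> is then at most the rounded-down value
    \<open>10 * n div 3\<close>.\<close>
  then have "\<forall>\<^sub>F n in sequentially. real (m n) / real n < 10 / 3"
    by (intro order_tendstoD(2)[OF assms]) simp
  then have "\<forall>\<^sub>F n in sequentially. m n \<le> 10 * n div 3"
    using eventually_gt_at_top[of 0]
  proof eventually_elim
    case (elim n)
    then have "3 * real (m n) < 10 * real n" by (simp add: field_simps)
    then have "real (3 * m n) < real (10 * n)" by simp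
    then have "3 * m n < 10 * n" by (simp only: of_nat_less_iff)
    then show ?case by linarith
  qed
  then show "(\<lambda>n. inj_prob (m n) n) \<longlonglongrightarrow> 0"
    by (rule inj_prob_tendsto_0)
qed

end
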